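(* Let $N_{\mathrm{sym}}(H)$ denote the number of nontrivial symmetric ideal degree-three Prouhet--Tarry--Escott solutions of size four and height at most $H$, with distinct admissible centers counted separately. Then, as $H\to\infty$, $$N_{\mathrm{sym}}(H)=\frac{4\log 2}{3\pi^2}\,H^3\log H+O(H^3).$$
   Context: An ideal degree-three Prouhet--Tarry--Escott (PTE) solution (of size four) is a pair $(A,B)$ of four-element multisets of integers $A=\{a_1,a_2,a_3,a_4\}$, $B=\{b_1,b_2,b_3,b_4\}$ (elements counted with multiplicity) with $\sum_{i=1}^4 a_i^\ell=\sum_{i=1}^4 b_i^\ell$ for $\ell=1,2,3$. It is trivial if $A=B$ as multisets, nontrivial otherwise. Its height is $\max\{|a|,|b|: a\in A,\ b\in B\}$. It is symmetric if there exists $c\in\frac12\mathbb Z$ (the center) such that both multisets $A-c=\{a-c:a\in A\}$ and $B-c=\{b-c:b\in B\}$ are invariant under sign reversal $t\mapsto -t$; both cases $c\in\mathbb Z$ and $c\in\mathbb Z+\frac12$ are included. Counting conventions: orderings of elements inside $A$ or inside $B$ are not distinguished (multisets), and $(A,B)$ is identified with $(B,A)$. Translates of a solution (i.e. solutions with different centers) are counted as different solutions; no quotient by translation or scaling is taken. Thus $N_{\mathrm{sym}}(H)$ is the number of unordered pairs $\{A,B\}$ of distinct four-element multisets of integers in $[-H,H]$ forming a symmetric ideal degree-three PTE solution. *)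

theory Defs
  imports Complex_Main "HOL-Library.Multiset" "HOL-Library.Landau_Symbols"
begin

definition pte3 :: "int multiset \<Rightarrow> int multiset \<Rightarrow> bool" where
  "pte3 A B \<longleftrightarrow> size A = 4 \<and> size B = 4 \<and>
     (\<forall>l\<in>{1..3::nat}. (\<Sum>a\<in>#A. a ^ l) = (\<Sum>b\<in>#B. b ^ l))"

definition pte_height :: "int multiset \<Rightarrow> int multiset \<Rightarrow> int" where
  "pte_height A B = Max (abs ` (set_mset A \<union> set_mset B))"

definition symmetric_about :: "real \<Rightarrow> int multiset \<Rightarrow> bool" where
  "symmetric_about c A \<longleftrightarrow>
     image_mset uminus {# of_int a - c. a \<in># A #} = {# of_int a - c. a \<in># A #}"

definition pte_symmetric :: "int multiset \<Rightarrow> int multiset \<Rightarrow> bool" where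
  "pte_symmetric A B \<longleftrightarrow> (\<exists>c::real. 2 * c \<in> \<int> \<and> symmetric_about c A \<and> symmetric_about c B)"

text \<open>
  Solutions are counted as unordered pairs \<open>{A, B}\<close>. Translates of a solution are different
  pairs, so solutions with different centers are counted separately (the center of a symmetric
  solution is unique, being the mean of \<open>A\<close>).
\<close>

definition N_sym :: "real \<Rightarrow> nat" where
  "N_sym H = card {{A, B} | A B.
     pte3 A B \<and> A \<noteq> B \<and> pte_symmetric A B \<and> of_int (pte_height A B) \<le> H}"

end

theory Submission
  imports Defs "HOL-Analysis.Analysis" "HOL-Real_Asymp.Real_Asymp"
begin

text \<open>
  A symmetric solution with \<open>2c = C\<close> consists of \<open>(C \<plusminus> U)/2, (C \<plusminus> V)/2\<close> and \<open>(C \<plusminus> X)/2, (C \<plusminus> Y)/2\<close>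
  with \<open>U > X \<ge> Y > V \<ge> 0\<close> and \<open>U\<^sup>2 - X\<^sup>2 = Y\<^sup>2 - V\<^sup>2\<close>. Factoring both sides gives \<open>p q = r s\<close>, hence
  \<open>U = a b + c d\<close>, \<open>X = c d - a b\<close>, \<open>Y = a c + b d\<close>, \<open>V = b d - a c\<close> with \<open>b < c\<close> coprime, and height at
  most \<open>n\<close> leaves \<open>2 n + 1 - U\<close> centers. For fixed \<open>(b, c)\<close> the order and parity conditions put
  \<open>(a, d)\<close> into a triangle (every point, or every second one when \<open>b + c\<close> is odd), so with
  \<open>M = 2 n + 1\<close> the weighted count is \<open>M\<^sup>3 f(b/c) / (6 c\<^sup>2)\<close>, or half of it, up to \<open>O(M\<^sup>2 / c)\<close>, where
  \<open>f(t) = min (t / (1 + t\<^sup>2)) ((1 - t) / (1 + 2 t - t\<^sup>2))\<close> has integral \<open>ln 2 / 4\<close> over \<open>[0, 1]\<close>.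
  The errors add up to \<open>O(M\<^sup>3)\<close>. The main terms are Riemann sums over coprime pairs, which
  produce the factor \<open>1/\<zeta>(2)\<close> and its analogue for odd pairs, and the harmonic sum over \<open>c\<close> produces
  the logarithm.
\<close>

section \<open>Sums of truncated powers\<close>

text \<open>In the factorisation of the difference, each of the \<open>m + 1\<close> summands of the
  cofactor lies between \<open>v ^ m\<close> and \<open>u ^ m\<close>.\<close>

lemma power_Suc_diff_bounds:
  fixes u v :: real
  assumes "0 \<le> v" "v \<le> u"
  shows "real (Suc m) * (u - v) * v ^ m \<le> u ^ Suc m - v ^ Suc m"
    and "u ^ Suc m - v ^ Suc m \<le> real (Suc m) * (u - v) * u ^ m"
proof -
  have eq: "u ^ Suc m - v ^ Suc m = (u - v) * (\<Sum>p<Suc m. u ^ p * v ^ (m - p))"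
    using diff_power_eq_sum[of u m v] by simp
  have "(\<Sum>p<Suc m. v ^ m) \<le> (\<Sum>p<Suc m. u ^ p * v ^ (m - p))"
  proof (rule sum_mono)
    fix p assume "p \<in> {..<Suc m}"
    then have "v ^ m = v ^ p * v ^ (m - p)" by (simp flip: power_add)
    also have "\<dots> \<le> u ^ p * v ^ (m - p)" using assms by (intro mult_right_mono power_mono) auto
    finally show "v ^ m \<le> u ^ p * v ^ (m - p)" .
  qed
  then have "(u - v) * (real (Suc m) * v ^ m) \<le> u ^ Suc m - v ^ Suc m"
    unfolding eq using assms by (intro mult_left_mono) auto
  then show "real (Suc m) * (u - v) * v ^ m \<le> u ^ Suc m - v ^ Suc m" by (simp add: mult_ac)
  have "(\<Sum>p<Suc m. u ^ p * v ^ (m - p)) \<le> (\<Sum>p<Suc m. u ^ m)"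
  proof (rule sum_mono)
    fix p assume "p \<in> {..<Suc m}"
    then have "u ^ m = u ^ p * u ^ (m - p)" by (simp flip: power_add)
    also have "\<dots> \<ge> u ^ p * v ^ (m - p)" using assms by (intro mult_left_mono power_mono) auto
    finally show "u ^ p * v ^ (m - p) \<le> u ^ m" .
  qed
  then have "u ^ Suc m - v ^ Suc m \<le> (u - v) * (real (Suc m) * u ^ m)"
    unfolding eq using assms by (intro mult_left_mono) auto
  then show "u ^ Suc m - v ^ Suc m \<le> real (Suc m) * (u - v) * u ^ m" by (simp add: mult_ac)
qed

text \<open>Models the number of admissible centers, which is linear in the lattice variable. The
  cut-off at 0 allows summation ranges to be enlarged without changing the sum.\<close>

definition ramp :: "real \<Rightarrow> real \<Rightarrow> real \<Rightarrow> real" where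
  "ramp P c x = max 0 (P - c * x)"

lemma ramp_nonneg [simp]: "0 \<le> ramp P c x"
  by (simp add: ramp_def)

lemma ramp_antimono: "0 \<le> c \<Longrightarrow> x \<le> y \<Longrightarrow> ramp P c y \<le> ramp P c x"
  unfolding ramp_def by (smt (verit) mult_left_mono)

lemma ramp_eq_0: "P \<le> c * x \<Longrightarrow> ramp P c x = 0"
  by (simp add: ramp_def)

text \<open>Up to sign, \<open>ramp P c x ^ Suc m / (real (Suc m) * c)\<close> is an antiderivative
  of the decreasing function \<open>ramp P c x ^ m\<close>, so both bounds compare an integral over
  \<open>[x, y]\<close> with a rectangle.\<close>

lemma ramp_power_bounds:
  assumes "0 < c" "x \<le> y" "0 < m"
  shows "(y - x) * ramp P c y ^ m \<le> (ramp P c x ^ Suc m - ramp P c y ^ Suc m) / (real (Suc m) * c)"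
    and "(ramp P c x ^ Suc m - ramp P c y ^ Suc m) / (real (Suc m) * c) \<le> (y - x) * ramp P c x ^ m"
proof -
  define u v where "u = ramp P c x" and "v = ramp P c y"
  have uv: "0 \<le> v" "v \<le> u" using assms ramp_antimono[of c x y P] by (auto simp: u_def v_def)
  have cy: "c * x \<le> c * y" using assms by simp
  have d: "u - v \<le> c * (y - x)" using cy unfolding u_def v_def ramp_def by (auto simp: algebra_simps)
  have cpos: "0 < real (Suc m) * c" using assms by simp
  have "c * (y - x) * v ^ m \<le> (u - v) * v ^ m"
  \<comment> \<open>Beyond the kink \<open>u - v\<close> can be smaller than
    \<open>c * (y - x)\<close>, but there \<open>v = 0\<close>, and \<open>v ^ m\<close> vanishes
    because \<open>0 < m\<close>.\<close>
  proof (cases "v = 0")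
    case True
    then show ?thesis using assms by (simp add: zero_power)
  next
    case False
    then have "u - v = c * (y - x)" using uv cy unfolding u_def v_def ramp_def by (auto simp: algebra_simps)
    then show ?thesis by simp
  qed
  then have "real (Suc m) * (c * (y - x) * v ^ m) \<le> real (Suc m) * ((u - v) * v ^ m)"
    by (rule mult_left_mono) simp
  also have "\<dots> \<le> u ^ Suc m - v ^ Suc m"
    using power_Suc_diff_bounds(1)[OF uv, of m] by (simp add: mult_ac)
  finally show "(y - x) * v ^ m \<le> (u ^ Suc m - v ^ Suc m) / (real (Suc m) * c)"
    using cpos by (simp add: pos_le_divide_eq mult_ac)
  have "u ^ Suc m - v ^ Suc m \<le> real (Suc m) * ((u - v) * u ^ m)"
    using power_Suc_diff_bounds(2)[OF uv, of m] by (simp add: mult_ac)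
  also have "\<dots> \<le> real (Suc m) * (c * (y - x) * u ^ m)"
    using d uv by (intro mult_left_mono mult_right_mono) auto
  finally show "(u ^ Suc m - v ^ Suc m) / (real (Suc m) * c) \<le> (y - x) * u ^ m"
    using cpos by (simp add: pos_divide_le_eq mult_ac)
qed

text \<open>Integral comparison for a decreasing function: the cell bounds telescope down from
  \<open>N\<close>, where \<open>ramp\<close> has already reached 0 and leaves no boundary
  term.\<close>

lemma sum_ramp_power_atLeastAtMost:
  assumes c: "0 < c" and m: "0 < m" and PN: "P \<le> c * real N" and iN: "i \<le> N"
  shows "ramp P c i ^ Suc m / (real (Suc m) * c) \<le> (\<Sum>e\<in>{i..N}. ramp P c (real e) ^ m)"
    and "(\<Sum>e\<in>{i..N}. ramp P c (real e) ^ m) \<le> ramp P c i ^ m + ramp P c i ^ Suc m / (real (Suc m) * c)"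
proof -
  let ?h = "\<lambda>x. ramp P c x ^ m" and ?\<phi> = "\<lambda>x. ramp P c x ^ Suc m / (real (Suc m) * c)"
  have N0: "ramp P c (real N) = 0" using PN by (rule ramp_eq_0)
  have "?\<phi> (real i) \<le> (\<Sum>e\<in>{i..N}. ?h (real e)) \<and> (\<Sum>e\<in>{i..N}. ?h (real e)) \<le> ?h (real i) + ?\<phi> (real i)"
    using iN
  proof (induction rule: inc_induct)
    case base
    show ?case using N0 m by simp
  next
    case (step n)
    have s: "(\<Sum>e\<in>{n..N}. ?h (real e)) = ?h (real n) + (\<Sum>e\<in>{Suc n..N}. ?h (real e))"
      using step.hyps by (simp add: sum.atLeast_Suc_atMost)
    have b: "?h (real (Suc n)) \<le> ?\<phi> (real n) - ?\<phi> (real (Suc n))"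
      "?\<phi> (real n) - ?\<phi> (real (Suc n)) \<le> ?h (real n)"
      using ramp_power_bounds[OF c _ m, of "real n" "real (Suc n)" P] by (simp_all add: diff_divide_distrib)
    show ?case using step.IH b unfolding s by linarith
  qed
  then show "?\<phi> (real i) \<le> (\<Sum>e\<in>{i..N}. ?h (real e))"
    and "(\<Sum>e\<in>{i..N}. ?h (real e)) \<le> ?h (real i) + ?\<phi> (real i)" by auto
qed

text \<open>Rounding \<open>E\<close> up to an integer drops at most one unit cell from the
  integral. This loss and the surplus first term have opposite signs, so a single value at
  \<open>E\<close> covers either.\<close>

lemma sum_ramp_power:
  assumes c: "0 < c" and m: "0 < m" and PN: "P \<le> c * real N" and E: "0 \<le> E"
  shows "\<bar>(\<Sum>e | e \<le> N \<and> E \<le> real e. ramp P c (real e) ^ m)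
           - ramp P c E ^ Suc m / (real (Suc m) * c)\<bar> \<le> ramp P c E ^ m"
proof -
  define i where "i = nat \<lceil>E\<rceil>"
  have i: "E \<le> real i" "real i - E \<le> 1" using E unfolding i_def by linarith+
  have set: "{e. e \<le> N \<and> E \<le> real e} = {i..N}" unfolding i_def using E by (auto simp: ceiling_le_iff nat_le_iff)
  show ?thesis
  proof (cases "i \<le> N")
    case True
    note b = sum_ramp_power_atLeastAtMost[OF c m PN True]
    note d = ramp_power_bounds[OF c i(1) m, of P]
    have h: "ramp P c i ^ m \<le> ramp P c E ^ m" using c i by (intro power_mono ramp_antimono) auto
    have "(real i - E) * ramp P c E ^ m \<le> 1 * ramp P c E ^ m" using i by (intro mult_right_mono) auto
    moreover have "0 \<le> (real i - E) * ramp P c i ^ m" using i by simp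
    ultimately show ?thesis unfolding set using b d h unfolding diff_divide_distrib by linarith
  next
    case False
    then have "real N \<le> E" unfolding i_def using E by linarith
    then have "ramp P c E = 0" using PN c by (smt (verit) mult_left_mono ramp_eq_0)
    then show ?thesis unfolding set using False m by simp
  qed
qed

section \<open>The limiting density and its Riemann sums\<close>

text \<open>The function \<open>f\<close> of the header at \<open>t = b / c\<close>. The first
  branch reflects the condition \<open>V \<ge> 0\<close>, the second one
  \<open>X \<ge> Y\<close>.\<close>

definition dens :: "real \<Rightarrow> real" where
  "dens t = min (t / (1 + t\<^sup>2)) ((1 - t) / (1 + 2 * t - t\<^sup>2))"

lemma dens_denom_ge_1:
  fixes t :: real
  assumes "t \<in> {0..1}" shows "1 \<le> 1 + 2 * t - t\<^sup>2"
proof -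
  have "t * t \<le> 1 * t" using assms by (intro mult_right_mono) auto
  then show ?thesis using assms unfolding power2_eq_square by auto
qed

lemma dens_bounds:
  assumes "t \<in> {0..1}" shows "0 \<le> dens t" "dens t \<le> 1"
proof -
  have d: "1 \<le> 1 + 2 * t - t\<^sup>2" using dens_denom_ge_1[OF assms] .
  show "0 \<le> dens t" unfolding dens_def using assms d by auto
  have "t / (1 + t\<^sup>2) \<le> 1" using assms by (simp add: divide_le_eq_1 add_pos_nonneg add_increasing2)
  then show "dens t \<le> 1" unfolding dens_def by auto
qed

text \<open>A minimum of two Lipschitz functions. In each difference \<open>x - y\<close> factors
  out, leaving a numerator of absolute value at most 3 over denominators that are at least
  1.\<close>

lemma dens_lipschitz:
  assumes x: "x \<in> {0..1}" and y: "y \<in> {0..1}"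
  shows "\<bar>dens x - dens y\<bar> \<le> 3 * \<bar>x - y\<bar>"
proof -
  have bound: "\<bar>w * v / d\<bar> \<le> 3 * \<bar>w\<bar>" if "\<bar>v\<bar> \<le> 3" "1 \<le> d" for w v d :: real
  proof -
    have "\<bar>w * v / d\<bar> = \<bar>w\<bar> * \<bar>v\<bar> / d" using that by (simp add: abs_mult)
    also have "\<dots> \<le> \<bar>w\<bar> * \<bar>v\<bar> / 1" using that by (intro divide_left_mono) auto
    also have "\<dots> \<le> \<bar>w\<bar> * 3" using that by (auto intro!: mult_left_mono)
    finally show ?thesis by simp
  qed
  have xy: "0 \<le> x * y" "x * y \<le> 1" using x y by (auto intro: mult_le_one)
  have xy': "0 \<le> (1 - x) * (1 - y)" "(1 - x) * (1 - y) \<le> 1"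
    using x y by (simp, intro mult_le_one) auto
  define p q where "p = 1 + 2 * x - x\<^sup>2" and "q = 1 + 2 * y - y\<^sup>2"
  have pq: "1 \<le> p" "1 \<le> q" using dens_denom_ge_1 x y by (auto simp: p_def q_def)
  have nz: "1 + x\<^sup>2 \<noteq> 0" "1 + y\<^sup>2 \<noteq> 0" by (simp_all add: add_nonneg_eq_0_iff)
  have e1: "x / (1 + x\<^sup>2) - y / (1 + y\<^sup>2) = (x - y) * (1 - x * y) / ((1 + x\<^sup>2) * (1 + y\<^sup>2))"
    using nz by (simp add: divide_simps) algebra
  have "(1 - x) / p - (1 - y) / q = ((1 - x) * q - (1 - y) * p) / (p * q)"
    using pq by (simp add: divide_simps)
  also have "(1 - x) * q - (1 - y) * p = (x - y) * - (2 + (1 - x) * (1 - y))"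
    unfolding p_def q_def by algebra
  finally have e2: "(1 - x) / p - (1 - y) / q = (x - y) * - (2 + (1 - x) * (1 - y)) / (p * q)" .
  have b1: "\<bar>x / (1 + x\<^sup>2) - y / (1 + y\<^sup>2)\<bar> \<le> 3 * \<bar>x - y\<bar>"
    unfolding e1 using xy mult_mono[of 1 "1 + x\<^sup>2" 1 "1 + y\<^sup>2"] by (intro bound) auto
  have b2: "\<bar>(1 - x) / p - (1 - y) / q\<bar> \<le> 3 * \<bar>x - y\<bar>"
    unfolding e2 using xy' pq mult_mono[of 1 p 1 q] by (intro bound) auto
  show ?thesis using b1 b2 unfolding dens_def p_def q_def by linarith
qed


text \<open>The branches cross at \<open>r = sqrt 2 - 1\<close>, the positive root of
  \<open>t^2 + 2 t = 1\<close>, and their antiderivatives are half the logarithms of their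
  denominators.\<close>

lemma dens_has_integral: "(dens has_integral ln 2 / 4) {0..1}"
proof -
  define r :: real where "r = sqrt 2 - 1"
  have s2: "sqrt 2 * sqrt 2 = (2::real)" by simp
  have r: "0 < r" "r < 1" using sqrt2_less_2 unfolding r_def by auto
  have rr: "r * r = 1 - 2 * r" unfolding r_def using s2 by (simp add: algebra_simps)
  have d: "0 < 1 + 2 * t - t\<^sup>2" if "0 \<le> t" "t \<le> 1" for t :: real
    using dens_denom_ge_1[of t] that by auto
  have cmp: "t / (1 + t\<^sup>2) \<le> (1 - t) / (1 + 2 * t - t\<^sup>2) \<longleftrightarrow> t\<^sup>2 + 2 * t \<le> 1"
    if t: "0 \<le> t" "t \<le> 1" for t :: real
  proof -
    have "t / (1 + t\<^sup>2) \<le> (1 - t) / (1 + 2 * t - t\<^sup>2) \<longleftrightarrow> t * (1 + 2 * t - t\<^sup>2) \<le> (1 - t) * (1 + t\<^sup>2)"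
      using d[OF t] by (simp add: divide_le_eq le_divide_eq add_pos_nonneg mult.commute)
    also have "\<dots> \<longleftrightarrow> t\<^sup>2 + 2 * t \<le> 1" by (simp add: algebra_simps power2_eq_square power3_eq_cube)
    finally show ?thesis .
  qed
  have cmp': "(1 - t) / (1 + 2 * t - t\<^sup>2) \<le> t / (1 + t\<^sup>2) \<longleftrightarrow> 1 \<le> t\<^sup>2 + 2 * t"
    if t: "0 \<le> t" "t \<le> 1" for t :: real
  proof -
    have "(1 - t) / (1 + 2 * t - t\<^sup>2) \<le> t / (1 + t\<^sup>2) \<longleftrightarrow> (1 - t) * (1 + t\<^sup>2) \<le> t * (1 + 2 * t - t\<^sup>2)"
      using d[OF t] by (simp add: divide_le_eq le_divide_eq add_pos_nonneg mult.commute)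
    also have "\<dots> \<longleftrightarrow> 1 \<le> t\<^sup>2 + 2 * t" by (simp add: algebra_simps power2_eq_square power3_eq_cube)
    finally show ?thesis .
  qed
  have I1: "((\<lambda>t. t / (1 + t\<^sup>2)) has_integral ln (1 + r\<^sup>2) / 2 - ln (1 + 0\<^sup>2) / 2) {0..r}"
  proof (rule fundamental_theorem_of_calculus)
    show "0 \<le> r" using r by simp
    fix t :: real assume t: "t \<in> {0..r}"
    have "0 < 1 + t\<^sup>2" by (simp add: add_pos_nonneg)
    then show "((\<lambda>t. ln (1 + t\<^sup>2) / 2) has_vector_derivative t / (1 + t\<^sup>2)) (at t within {0..r})"
      by (auto intro!: derivative_eq_intros simp: divide_simps
            simp flip: has_real_derivative_iff_has_vector_derivative)
  qed
  have J1: "(dens has_integral ln (1 + r\<^sup>2) / 2 - ln (1 + 0\<^sup>2) / 2) {0..r}"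
  proof (rule has_integral_eq[OF _ I1])
    fix t assume t: "t \<in> {0..r}"
    then have "t * t \<le> r * r" by (intro mult_mono) auto
    then have "t\<^sup>2 + 2 * t \<le> 1" using rr t by (simp add: power2_eq_square)
    then show "t / (1 + t\<^sup>2) = dens t" using cmp[of t] t r unfolding dens_def by auto
  qed
  have I2: "((\<lambda>t. (1 - t) / (1 + 2 * t - t\<^sup>2)) has_integral
       ln (1 + 2 * 1 - 1\<^sup>2) / 2 - ln (1 + 2 * r - r\<^sup>2) / 2) {r..1}"
  proof (rule fundamental_theorem_of_calculus)
    show "r \<le> 1" using r by simp
    fix t :: real assume t: "t \<in> {r..1}"
    have "0 < 1 + 2 * t - t\<^sup>2" using d t r by auto
    then show "((\<lambda>t. ln (1 + 2 * t - t\<^sup>2) / 2) has_vector_derivative (1 - t) / (1 + 2 * t - t\<^sup>2)) (at t within {r..1})"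
      by (auto intro!: derivative_eq_intros simp: field_simps
            simp flip: has_real_derivative_iff_has_vector_derivative)
  qed
  have J2: "(dens has_integral ln (1 + 2 * 1 - 1\<^sup>2) / 2 - ln (1 + 2 * r - r\<^sup>2) / 2) {r..1}"
  proof (rule has_integral_eq[OF _ I2])
    fix t assume t: "t \<in> {r..1}"
    then have "r * r \<le> t * t" using r by (intro mult_mono) auto
    then have "1 \<le> t\<^sup>2 + 2 * t" using rr t by (simp add: power2_eq_square)
    then show "(1 - t) / (1 + 2 * t - t\<^sup>2) = dens t" using cmp'[of t] t r unfolding dens_def by auto
  qed
  \<comment> \<open>At the crossing point both denominators are multiples of \<open>r\<close>, so
    \<open>ln r\<close> cancels and only powers of 2 remain.\<close>
  have v1: "1 + r\<^sup>2 = 2 * (sqrt 2 * r)"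
    unfolding r_def using s2 by (simp add: algebra_simps power2_eq_square)
  have v2: "1 + 2 * r - r\<^sup>2 = 2 * (2 * r)" using rr by (simp add: power2_eq_square)
  have "ln (1 + r\<^sup>2) = ln 2 + (ln 2 / 2 + ln r)"
    unfolding v1 using r by (simp add: ln_mult ln_sqrt)
  moreover have "ln (1 + 2 * r - r\<^sup>2) = ln 2 + (ln 2 + ln r)"
    unfolding v2 using r ln_mult[of 2 "2 * r"] ln_mult[of 2 r] by simp
  ultimately have val: "(ln (1 + r\<^sup>2) / 2 - ln (1 + 0\<^sup>2) / 2) + (ln (1 + 2 * 1 - 1\<^sup>2) / 2 - ln (1 + 2 * r - r\<^sup>2) / 2)
     = ln (2::real) / 4" by (simp add: field_simps)
  show ?thesis unfolding val[symmetric] using r by (intro has_integral_combine[OF _ _ J1 J2]) auto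
qed

text \<open>On a cell of length \<open>1 / c\<close> the left endpoint value errs by at most
  \<open>L / c\<close>, which costs \<open>L / c^2\<close> per cell and \<open>L / c\<close> in
  total; rescaling by \<open>c\<close> gives \<open>L\<close>.\<close>

lemma lipschitz_Riemann_sum:
  fixes f :: "real \<Rightarrow> real"
  assumes lip: "\<And>x y. x \<in> {0..1} \<Longrightarrow> y \<in> {0..1} \<Longrightarrow> \<bar>f x - f y\<bar> \<le> L * \<bar>x - y\<bar>"
    and int: "(f has_integral I) {0..1}" and c: "0 < c"
  shows "\<bar>(\<Sum>b<c. f (real b / real c)) - real c * I\<bar> \<le> L"
proof -
  define \<Phi> where "\<Phi> x = integral {0..x} f" for x
  have L: "0 \<le> L" using lip[of 0 1] by auto
  have cell: "\<bar>f (real b / real c) / real c - (\<Phi> (real (Suc b) / real c) - \<Phi> (real b / real c))\<bar>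
               \<le> L / real c * (1 / real c)" if b: "b < c" for b
  proof -
    define x y where "x = real b / real c" and "y = real (Suc b) / real c"
    have xy: "0 \<le> x" "x \<le> y" "y \<le> 1" and yx: "y - x = 1 / real c"
      using b c by (auto simp: x_def y_def divide_simps)
    have fi: "f integrable_on {0..y}" "f integrable_on {x..y}"
      using int xy by (auto intro: integrable_subinterval_real dest!: has_integral_integrable)
    have "\<Phi> x + integral {x..y} f = \<Phi> y"
      unfolding \<Phi>_def using xy fi by (intro Henstock_Kurzweil_Integration.integral_combine) auto
    moreover have "((\<lambda>t. f t - f x) has_integral integral {x..y} f - (y - x) * f x) {x..y}"
      using has_integral_diff[OF integrable_integral[OF fi(2)] has_integral_const_real[of "f x" x y]] xy by simp
    then have "norm (integral {x..y} f - (y - x) * f x) \<le> L / real c * measure lborel {x..y}"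
    proof (rule has_integral_bound_real[where S = "{}", rotated 2])
      show "0 \<le> L / real c" using L by simp
      show "norm (f t - f x) \<le> L / real c" if "t \<in> {x..y} - {}" for t
      proof -
        have "\<bar>f t - f x\<bar> \<le> L * \<bar>t - x\<bar>" using that xy by (intro lip) auto
        also have "\<dots> \<le> L * (1 / real c)" using that L yx by (intro mult_left_mono) auto
        finally show ?thesis by simp
      qed
    qed auto
    ultimately show ?thesis unfolding x_def[symmetric] y_def[symmetric] using xy yx by (simp add: abs_minus_commute)
  qed
  have "(\<Sum>b<c. \<Phi> (real (Suc b) / real c) - \<Phi> (real b / real c)) = \<Phi> (real c / real c) - \<Phi> (real 0 / real c)"
    by (rule sum_lessThan_telescope)
  also have "\<dots> = I" using c int by (simp add: \<Phi>_def integral_unique)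
  finally have tele: "(\<Sum>b<c. \<Phi> (real (Suc b) / real c) - \<Phi> (real b / real c)) = I" .
  have "\<bar>(\<Sum>b<c. f (real b / real c)) / real c - I\<bar>
     = \<bar>\<Sum>b<c. f (real b / real c) / real c - (\<Phi> (real (Suc b) / real c) - \<Phi> (real b / real c))\<bar>"
    by (simp only: tele[symmetric] sum_subtractf sum_divide_distrib)
  also have "\<dots> \<le> (\<Sum>b<c. L / real c * (1 / real c))"
    by (rule order.trans[OF sum_abs sum_mono]) (use cell in auto)
  also have "\<dots> = L / real c" using c by simp
  finally have "real c * \<bar>(\<Sum>b<c. f (real b / real c)) / real c - I\<bar> \<le> real c * (L / real c)"
    by (rule mult_left_mono) simp
  moreover have "real c * \<bar>(\<Sum>b<c. f (real b / real c)) / real c - I\<bar> = \<bar>(\<Sum>b<c. f (real b / real c)) - real c * I\<bar>"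
    using c by (simp add: field_simps flip: abs_mult_pos')
  ultimately show ?thesis using c by simp
qed

lemma sum_odd_eq:
  fixes g :: "nat \<Rightarrow> real"
  assumes "finite A"
  shows "(\<Sum>b | b \<in> A \<and> odd b. g b) = ((\<Sum>b\<in>A. g b) - (\<Sum>b\<in>A. (- 1) ^ b * g b)) / 2"
proof -
  have "(\<Sum>b | b \<in> A \<and> odd b. g b) = (\<Sum>b\<in>A. if odd b then g b else 0)"
    using assms by (simp add: sum.inter_filter)
  also have "\<dots> = (\<Sum>b\<in>A. (g b - (- 1) ^ b * g b) / 2)"
    by (intro sum.cong) auto
  finally show ?thesis by (simp add: sum_subtractf flip: sum_divide_distrib)
qed

text \<open>Consecutive terms are paired off at a cost of at most \<open>\<delta>\<close> per pair,
  and an unpaired term costs at most \<open>B\<close>; hence the induction in steps of two.\<close>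

lemma alternating_sum_bound:
  fixes g :: "nat \<Rightarrow> real"
  assumes "\<And>b. Suc b < n \<Longrightarrow> \<bar>g (Suc b) - g b\<bar> \<le> \<delta>" and "\<And>b. b < n \<Longrightarrow> \<bar>g b\<bar> \<le> B" and "0 \<le> B" "0 \<le> \<delta>"
  shows "\<bar>\<Sum>b<n. (- 1) ^ b * g b\<bar> \<le> real n * \<delta> + B"
  using assms(1,2)
proof (induction n rule: induct_nat_012)
  case 0
  then show ?case using assms by simp
next
  case 1
  then show ?case using assms by simp
next
  case (ge2 n)
  have "\<bar>\<Sum>b<n. (- 1) ^ b * g b\<bar> \<le> real n * \<delta> + B" using ge2 by auto
  moreover have "(\<Sum>b<Suc (Suc n). (- 1) ^ b * g b) = (\<Sum>b<n. (- 1) ^ b * g b) + (- 1) ^ n * (g n - g (Suc n))"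
    by (simp add: algebra_simps)
  moreover have "\<bar>(- 1) ^ n * (g n - g (Suc n))\<bar> \<le> \<delta>"
    using ge2.prems(1)[of n] by (simp add: abs_mult power_abs abs_minus_commute)
  ultimately show ?case using \<open>0 \<le> \<delta>\<close> by (simp add: algebra_simps)
qed

section \<open>Sums over coprime pairs\<close>

text \<open>Keeps the total error finite when \<open>ln (n div g)\<close> is replaced by
  \<open>ln n\<close> under the weights \<open>1 / g^2\<close>. The estimate
  \<open>ln (2 x) \<le> 2 sqrt x\<close> reduces it to the exponent 3/2.\<close>

lemma summable_ln_over_square: "summable (\<lambda>g. ln (2 * real (Suc g)) / (real (Suc g))\<^sup>2)"
proof (rule summable_comparison_test')
  have "summable (\<lambda>n. real n powr - (3/2))" by (simp add: summable_real_powr_iff)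
  then have "summable (\<lambda>n. real (Suc n) powr - (3/2))" by (subst summable_Suc_iff)
  then show "summable (\<lambda>n. 2 * real (Suc n) powr - (3/2))" by (rule summable_mult)
  fix n :: nat
  define x where "x = real (Suc n)"
  have x: "1 \<le> x" by (simp add: x_def)
  have "ln (2 * x) = ln 2 + 2 * ln (sqrt x)" using x by (simp add: ln_mult ln_sqrt)
  also have "\<dots> \<le> 1 + 2 * (sqrt x - 1)" using ln_le_minus_one[of "sqrt x"] ln_2_less_1 x by auto
  also have "\<dots> \<le> 2 * sqrt x" by simp
  finally have "ln (2 * x) / x\<^sup>2 \<le> 2 * sqrt x / x\<^sup>2" by (intro divide_right_mono) auto
  moreover have "sqrt x / x\<^sup>2 = x powr (1/2 - 2)"
    unfolding powr_diff using x by (simp add: powr_half_sqrt)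
  then have "2 * sqrt x / x\<^sup>2 = 2 * x powr (1/2 - 2)" by simp
  ultimately show "norm (ln (2 * real (Suc n)) / (real (Suc n))\<^sup>2) \<le> 2 * real (Suc n) powr - (3/2)"
    using x unfolding x_def by simp
qed

text \<open>The term \<open>g = 2\<close> gives 1/4, and from 3 on \<open>1 / g^2\<close> is at most
  \<open>1 / (g - 1) - 1 / g\<close>, which telescopes to at most 1/2.\<close>

lemma sum_inverse_squares_from_2_le: "(\<Sum>g\<in>{2..n}. 1 / (real g)\<^sup>2) \<le> 3 / 4"
proof -
  have "(\<Sum>g\<in>{2..n}. 1 / (real g)\<^sup>2) \<le> 3 / 4 - (if 2 \<le> n then 1 / real n else 3 / 4)"
  proof (induction n)
    case (Suc n)
    consider "Suc n < 2" | "n = 1" | "2 \<le> n" by linarith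
    then show ?case
    proof cases
      case 3
      have "1 / (real (Suc n))\<^sup>2 \<le> 1 / real n - 1 / real (Suc n)"
      proof -
        have "1 / (real (Suc n))\<^sup>2 \<le> 1 / (real n * real (Suc n))"
          using 3 by (intro divide_left_mono) (auto simp: power2_eq_square)
        also have "\<dots> = 1 / real n - 1 / real (Suc n)" using 3 by (simp add: field_simps)
        finally show ?thesis .
      qed
      then show ?thesis using Suc 3 by simp
    qed auto
  qed auto
  moreover have "(0::real) \<le> (if 2 \<le> n then 1 / real n else 3 / 4)" by simp
  ultimately show ?thesis by linarith
qed

text \<open>
  This replaces Moebius inversion: the terms with \<open>g \<ge> 2\<close> carry total mass less than one,
  so the error term is controlled by strong induction.
\<close>

lemma dilation_sum_asymp:
  fixes S A :: "nat \<Rightarrow> real" and P :: "nat \<Rightarrow> bool"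
  assumes P1: "P 1" and S0: "S 0 = 0"
    and A: "\<And>n. A n = (\<Sum>g | g \<in> {1..n} \<and> P g. S (n div g) / (real g)\<^sup>2)"
    and bound: "\<And>n. 1 \<le> n \<Longrightarrow> \<bar>A n - \<kappa> * Z * ln (real n)\<bar> \<le> B"
    and Z: "(\<lambda>g. (if P (Suc g) then 1 else 0) / (real (Suc g))\<^sup>2) sums Z"
  shows "\<exists>C. \<forall>n\<ge>1. \<bar>S n - \<kappa> * ln (real n)\<bar> \<le> C"
proof -
  define W where "W = (\<Sum>g. ln (2 * real (Suc g)) / (real (Suc g))\<^sup>2)"
  define G where "G n = {g. g \<in> {1..n} \<and> P g}" for n
  have finG: "finite (G n)" for n by (simp add: G_def)
  define R where "R n = S n - \<kappa> * ln (real n)" for n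
  \<comment> \<open>For \<open>g \<le> n\<close> one has \<open>n \<le> 2 * g * (n div g)\<close>,
    and for larger \<open>g\<close> simply \<open>n < g\<close>. Either way the discrepancy in a
    single term is at most \<open>ln (2 g) / g^2\<close>, so \<open>W\<close> covers the finite sum
    and the tail of \<open>Z\<close> together.\<close>
  have lnsum: "\<bar>Z * ln (real n) - (\<Sum>g\<in>G n. ln (real (n div g)) / (real g)\<^sup>2)\<bar> \<le> W" if n: "1 \<le> n" for n
  proof -
    define u where "u g = (if P g then 1 else 0) / (real g)\<^sup>2 * ln (real n)
        - (if g \<le> n \<and> P g then ln (real (n div g)) / (real g)\<^sup>2 else 0)" for g :: nat
    have "(\<lambda>g. if Suc g \<in> G n then ln (real (n div Suc g)) / (real (Suc g))\<^sup>2 else 0)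
           sums (\<Sum>g\<in>{..<n}. if Suc g \<in> G n then ln (real (n div Suc g)) / (real (Suc g))\<^sup>2 else 0)"
      by (rule sums_finite) (auto simp: G_def)
    also have "(\<Sum>g\<in>{..<n}. if Suc g \<in> G n then ln (real (n div Suc g)) / (real (Suc g))\<^sup>2 else 0)
        = (\<Sum>g\<in>{1..n}. if g \<in> G n then ln (real (n div g)) / (real g)\<^sup>2 else 0)"
      by (rule sum.reindex_bij_witness[of _ "\<lambda>g. g - 1" Suc]) auto
    also have "\<dots> = (\<Sum>g\<in>G n. ln (real (n div g)) / (real g)\<^sup>2)"
      unfolding G_def by (subst sum.inter_filter) (auto intro!: sum.cong)
    finally have us: "(\<lambda>g. u (Suc g)) sums (Z * ln (real n) - (\<Sum>g\<in>G n. ln (real (n div g)) / (real g)\<^sup>2))"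
      unfolding u_def using Z by (intro sums_diff sums_mult2) (auto simp: G_def)
    have ub: "\<bar>u (Suc g)\<bar> \<le> ln (2 * real (Suc g)) / (real (Suc g))\<^sup>2" for g
    proof -
      define h where "h = Suc g"
      have h: "1 \<le> h" by (simp add: h_def)
      have l2: "0 \<le> ln (2 * real h)" using h by simp
      have "\<bar>u h\<bar> = (if P h then \<bar>ln (real n) - (if h \<le> n then ln (real (n div h)) else 0)\<bar> else 0) / (real h)\<^sup>2"
        unfolding u_def using h by (auto simp: abs_mult simp flip: diff_divide_distrib)
      also have "\<dots> \<le> ln (2 * real h) / (real h)\<^sup>2"
      proof (intro divide_right_mono)
        have "\<bar>ln (real n) - (if h \<le> n then ln (real (n div h)) else 0)\<bar> \<le> ln (2 * real h)"
        proof (cases "h \<le> n")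
          case True
          have q: "1 \<le> n div h" using True h by (simp add: div_greater_zero_iff Suc_le_eq)
          have "n < h * (n div h) + h" using h by (metis add.commute add_strict_left_mono mult.commute div_mult_mod_eq mod_less_divisor less_eq_Suc_le One_nat_def)
          also have "\<dots> \<le> h * (n div h) + h * (n div h)" using q by simp
          finally have "n \<le> 2 * h * (n div h)" by simp
          then have "real n \<le> 2 * real h * real (n div h)" by (metis of_nat_le_iff of_nat_mult of_nat_numeral)
          then have "ln (real n) \<le> ln (2 * real h * real (n div h))" using n q h by (subst ln_le_cancel_iff) auto
          also have "\<dots> = ln (2 * real h) + ln (real (n div h))" using h q by (subst ln_mult) auto
          finally have "ln (real n) \<le> ln (2 * real h) + ln (real (n div h))" .
          moreover have "ln (real (n div h)) \<le> ln (real n)" using q n by (subst ln_le_cancel_iff) auto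
          ultimately show ?thesis using True l2 by simp
        next
          case False
          then have "ln (real n) \<le> ln (2 * real h)" using n by (subst ln_le_cancel_iff) auto
          then show ?thesis using False n by simp
        qed
        then show "(if P h then \<bar>ln (real n) - (if h \<le> n then ln (real (n div h)) else 0)\<bar> else 0) \<le> ln (2 * real h)"
          using l2 by simp
      qed simp
      finally show ?thesis unfolding h_def .
    qed
    show ?thesis unfolding W_def sums_unique[OF us]
      using ub summable_ln_over_square by (intro norm_suminf_le[where 'a = real, simplified]) auto
  qed
  define M where "M = B + \<bar>\<kappa>\<bar> * W"
  have RA: "\<bar>\<Sum>g\<in>G n. R (n div g) / (real g)\<^sup>2\<bar> \<le> M" if n: "1 \<le> n" for n
  proof -
    let ?L = "\<Sum>g\<in>G n. ln (real (n div g)) / (real g)\<^sup>2"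
    have "(\<Sum>g\<in>G n. R (n div g) / (real g)\<^sup>2) = A n - \<kappa> * ?L"
      unfolding A R_def G_def[symmetric] by (simp add: diff_divide_distrib sum_subtractf sum_distrib_left)
    also have "\<dots> = (A n - \<kappa> * Z * ln (real n)) + \<kappa> * (Z * ln (real n) - ?L)" by (simp add: algebra_simps)
    also have "\<bar>\<dots>\<bar> \<le> B + \<bar>\<kappa>\<bar> * W"
      using bound[OF n] mult_left_mono[OF lnsum[OF n], of "\<bar>\<kappa>\<bar>"] 
      by (intro order.trans[OF abs_triangle_ineq] add_mono) (auto simp: abs_mult)
    finally show ?thesis unfolding M_def .
  qed
  \<comment> \<open>The constant solves \<open>K = M + 3/4 K\<close>: the full sum contributes
    \<open>M\<close>, the terms with \<open>g \<ge> 2\<close> at most three quarters of the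
    inductive bound.\<close>
  have "\<bar>R n\<bar> \<le> 4 * M" if "1 \<le> n" for n
    using that
  proof (induction n rule: less_induct)
    case (less n)
    have M0: "0 \<le> M" using RA[of 1] by linarith
    have "(\<Sum>g\<in>G n. R (n div g) / (real g)\<^sup>2) = R n + (\<Sum>g\<in>G n - {1}. R (n div g) / (real g)\<^sup>2)"
      using less.prems P1 finG by (subst sum.remove[of _ 1]) (auto simp: G_def)
    moreover have "\<bar>\<Sum>g\<in>G n - {1}. R (n div g) / (real g)\<^sup>2\<bar> \<le> 3 * M"
    proof -
      have "\<bar>\<Sum>g\<in>G n - {1}. R (n div g) / (real g)\<^sup>2\<bar> \<le> (\<Sum>g\<in>G n - {1}. 4 * M * (1 / (real g)\<^sup>2))"
      proof (rule order.trans[OF sum_abs sum_mono])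
        fix g assume g: "g \<in> G n - {1}"
        then have "\<bar>R (n div g)\<bar> \<le> 4 * M"
          using less.prems by (intro less.IH) (auto simp: G_def div_greater_zero_iff Suc_le_eq)
        then show "\<bar>R (n div g) / (real g)\<^sup>2\<bar> \<le> 4 * M * (1 / (real g)\<^sup>2)"
          by (simp add: divide_right_mono)
      qed
      also have "\<dots> \<le> (\<Sum>g\<in>{2..n}. 4 * M * (1 / (real g)\<^sup>2))"
        using M0 by (intro sum_mono2) (auto simp: G_def)
      also have "\<dots> = 4 * M * (\<Sum>g\<in>{2..n}. 1 / (real g)\<^sup>2)" by (simp add: sum_distrib_left)
      also have "\<dots> \<le> 4 * M * (3 / 4)" using M0 sum_inverse_squares_from_2_le by (intro mult_left_mono) auto
      finally show ?thesis by simp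
    qed
    ultimately show ?case using RA[OF less.prems] by linarith
  qed
  then show ?thesis unfolding R_def by blast
qed

definition coprime_pairs :: "(nat \<Rightarrow> bool) \<Rightarrow> nat \<Rightarrow> (nat \<times> nat) set" where
  "coprime_pairs P n = {(b, c). 0 < b \<and> b < c \<and> c \<le> n \<and> P b \<and> P c \<and> coprime b c}"

lemma finite_coprime_pairs [simp]: "finite (coprime_pairs P n)"
  by (rule finite_subset[of _ "{..n} \<times> {..n}"]) (auto simp: coprime_pairs_def)

text \<open>Every pair is \<open>g\<close> times a coprime pair in exactly one way. \<open>P\<close>
  passes to the factors, \<open>F\<close> scales by \<open>1 / g^2\<close>, and the bound
  \<open>n\<close> on \<open>c\<close> becomes \<open>n div g\<close>.\<close>

lemma sum_pairs_by_gcd: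
  fixes F :: "nat \<Rightarrow> nat \<Rightarrow> real"
  assumes P: "\<And>g b. 0 < g \<Longrightarrow> 0 < b \<Longrightarrow> P (g * b) \<longleftrightarrow> P g \<and> P b"
    and F: "\<And>g b c. 0 < g \<Longrightarrow> F (g * b) (g * c) = F b c / (real g)\<^sup>2"
  shows "(\<Sum>(b, c) | 0 < b \<and> b < c \<and> c \<le> n \<and> P b \<and> P c. F b c)
    = (\<Sum>g | g \<in> {1..n} \<and> P g. (\<Sum>(b, c)\<in>coprime_pairs P (n div g). F b c) / (real g)\<^sup>2)"
proof -
  let ?G = "{g. g \<in> {1..n} \<and> P g}"
  have "(\<Sum>g\<in>?G. (\<Sum>(b, c)\<in>coprime_pairs P (n div g). F b c) / (real g)\<^sup>2)
      = (\<Sum>g\<in>?G. \<Sum>x\<in>coprime_pairs P (n div g). F (fst x) (snd x) / (real g)\<^sup>2)"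
    by (simp add: sum_divide_distrib case_prod_beta)
  also have "\<dots> = (\<Sum>(g, x)\<in>Sigma ?G (\<lambda>g. coprime_pairs P (n div g)). F (fst x) (snd x) / (real g)\<^sup>2)"
    by (subst sum.Sigma) auto
  also have "\<dots> = (\<Sum>(b, c) | 0 < b \<and> b < c \<and> c \<le> n \<and> P b \<and> P c. F b c)"
  proof (rule sum.reindex_bij_witness[of _ "\<lambda>(b, c). (gcd b c, b div gcd b c, c div gcd b c)"
        "\<lambda>(g, b, c). (g * b, g * c)"], goal_cases)
    case (1 x)
    then show ?case by (auto simp: coprime_pairs_def gcd_mult_distrib_nat[symmetric])
  next
    case (2 x)
    then show ?case using P
      by (auto simp: coprime_pairs_def less_eq_div_iff_mult_less_eq mult.commute intro: mult_strict_left_mono)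
  next
    case (3 x)
    then show ?case by auto
  next
    case (4 x)
    then obtain b c where x: "x = (b, c)" "0 < b" "b < c" "c \<le> n" "P b" "P c" by auto
    define g where "g = gcd b c"
    have g: "0 < g" using x by (simp add: g_def)
    then obtain b' c' where b: "b = g * b'" and c: "c = g * c'" and cop: "coprime b' c'"
      using gcd_coprime_exists[of b c] unfolding g_def by (metis less_not_refl mult.commute)
    have pos: "0 < b'" using x(2) b by (cases "b' = 0") auto
    have lt: "b' < c'" using x(3) unfolding b c by simp
    have pos': "0 < c'" using lt by simp
    have Pg: "P g" "P b'" "P c'" using x(5,6) P[OF g pos] P[OF g pos'] b c by auto
    have le: "g \<le> n" using x(4) pos' unfolding c by (metis One_nat_def Suc_leI le_trans mult.right_neutral mult_le_mono2)
    have div: "c' \<le> n div g" using x(4) g unfolding c by (simp add: less_eq_div_iff_mult_less_eq mult.commute)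
    have "b div g = b'" "c div g = c'" using g b c by simp_all
    then show ?case unfolding x(1) prod.case g_def[symmetric]
      using g pos pos' lt Pg le div cop by (simp add: coprime_pairs_def)
  next
    case (5 x)
    then show ?case by (auto simp: F)
  qed
  finally show ?thesis ..
qed

text \<open>\<open>\<delta>\<close> acts as the density of \<open>P\<close>. It enters once through
  the Riemann sum over \<open>b\<close> and once through the harmonic sum over \<open>c\<close>, so
  that all pairs together give \<open>\<delta>^2 I ln n\<close>; common factors are then removed by
  \<open>dilation_sum_asymp\<close>, which divides by \<open>Z\<close>.\<close>

lemma coprime_pairs_dens_sum:
  fixes P :: "nat \<Rightarrow> bool"
  assumes P1: "P 1" and P: "\<And>g b. 0 < g \<Longrightarrow> 0 < b \<Longrightarrow> P (g * b) \<longleftrightarrow> P g \<and> P b"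
    and riemann: "\<And>c. 0 < c \<Longrightarrow> P c \<Longrightarrow>
        \<bar>(\<Sum>b | b < c \<and> P b. dens (real b / real c)) - \<delta> * I * real c\<bar> \<le> B1"
    and harmonic: "\<And>n. 1 \<le> n \<Longrightarrow> \<bar>(\<Sum>c | c \<in> {1..n} \<and> P c. 1 / real c) - \<delta> * ln (real n)\<bar> \<le> B2"
    and Z: "(\<lambda>g. (if P (Suc g) then 1 else 0) / (real (Suc g))\<^sup>2) sums Z" and Z0: "Z \<noteq> 0"
  shows "\<exists>C. \<forall>n\<ge>1. \<bar>(\<Sum>(b, c)\<in>coprime_pairs P n. dens (real b / real c) / (real c)\<^sup>2)
                     - \<delta>\<^sup>2 * I / Z * ln (real n)\<bar> \<le> C"
proof -
  define F where "F b c = dens (real b / real c) / (real c)\<^sup>2" for b c :: nat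
  define A where "A n = (\<Sum>(b, c) | 0 < b \<and> b < c \<and> c \<le> n \<and> P b \<and> P c. F b c)" for n
  define S where "S n = (\<Sum>(b, c)\<in>coprime_pairs P n. F b c)" for n
  have A: "A n = (\<Sum>g | g \<in> {1..n} \<and> P g. S (n div g) / (real g)\<^sup>2)" for n
    unfolding A_def S_def by (rule sum_pairs_by_gcd[OF P]) (auto simp: F_def power_mult_distrib)
  have "coprime_pairs P 0 = {}" by (auto simp: coprime_pairs_def)
  then have S0: "S 0 = 0" by (simp add: S_def)
  have B1: "0 \<le> B1" using riemann[of 1] P1 by linarith
  have "\<bar>A n - \<delta>\<^sup>2 * I * ln (real n)\<bar> \<le> 2 * B1 + \<bar>\<delta> * I\<bar> * B2" if n: "1 \<le> n" for n
  proof -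
    let ?C = "{c. c \<in> {1..n} \<and> P c}"
    define r where "r c = (\<Sum>b | b < c \<and> P b. dens (real b / real c))" for c
    have F0: "F 0 c = 0" for c by (simp add: F_def dens_def)
    have "A n = (\<Sum>(c, b)\<in>Sigma ?C (\<lambda>c. {b. 0 < b \<and> b < c \<and> P b}). F b c)"
      unfolding A_def by (rule sum.reindex_bij_witness[of _ "\<lambda>(c, b). (b, c)" "\<lambda>(b, c). (c, b)"]) auto
    also have "\<dots> = (\<Sum>c\<in>?C. \<Sum>b | 0 < b \<and> b < c \<and> P b. F b c)"
      by (subst sum.Sigma) auto
    \<comment> \<open>The term \<open>b = 0\<close> is added to match the range of the Riemann sum;
      it is 0 because \<open>dens 0 = 0\<close>.\<close>
    also have "\<dots> = (\<Sum>c\<in>?C. \<Sum>b | b < c \<and> P b. F b c)"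
    proof (rule sum.cong[OF refl])
      show "(\<Sum>b | 0 < b \<and> b < c \<and> P b. F b c) = (\<Sum>b | b < c \<and> P b. F b c)" for c
        by (rule sum.mono_neutral_left) (auto, metis F0 gr0I)
    qed
    also have "\<dots> = (\<Sum>c\<in>?C. r c / (real c)\<^sup>2)"
      unfolding r_def F_def by (simp add: sum_divide_distrib)
    finally have An: "A n = (\<Sum>c\<in>?C. r c / (real c)\<^sup>2)" .
    have "\<bar>A n - \<delta> * I * (\<Sum>c\<in>?C. 1 / real c)\<bar> = \<bar>\<Sum>c\<in>?C. (r c - \<delta> * I * real c) / (real c)\<^sup>2\<bar>"
      unfolding An sum_distrib_left sum_subtractf[symmetric]
      by (intro arg_cong[where f = abs] sum.cong) (auto simp: field_simps power2_eq_square)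
    also have "\<dots> \<le> (\<Sum>c\<in>?C. B1 * (1 / (real c)\<^sup>2))"
    proof (rule order.trans[OF sum_abs sum_mono])
      fix c assume "c \<in> ?C"
      then have "\<bar>r c - \<delta> * I * real c\<bar> \<le> B1" unfolding r_def using riemann[of c] by auto
      then show "\<bar>(r c - \<delta> * I * real c) / (real c)\<^sup>2\<bar> \<le> B1 * (1 / (real c)\<^sup>2)"
        by (simp add: divide_right_mono)
    qed
    also have "\<dots> \<le> (\<Sum>c\<in>{1..n}. B1 * (1 / (real c)\<^sup>2))" using B1 by (intro sum_mono2) auto
    also have "\<dots> = B1 * (1 + (\<Sum>c\<in>{2..n}. 1 / (real c)\<^sup>2))"
      using n unfolding sum_distrib_left[symmetric] by (subst sum.atLeast_Suc_atMost) (auto simp: numeral_2_eq_2)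
    also have "\<dots> \<le> B1 * 2" using B1 sum_inverse_squares_from_2_le[of n] by (intro mult_left_mono) auto
    finally have 1: "\<bar>A n - \<delta> * I * (\<Sum>c\<in>?C. 1 / real c)\<bar> \<le> 2 * B1" by simp
    have "\<bar>\<delta> * I * (\<Sum>c\<in>?C. 1 / real c) - \<delta> * I * (\<delta> * ln (real n))\<bar> \<le> \<bar>\<delta> * I\<bar> * B2"
      using mult_left_mono[OF harmonic[OF n], of "\<bar>\<delta> * I\<bar>"] by (simp flip: right_diff_distrib abs_mult)
    then have 2: "\<bar>\<delta> * I * (\<Sum>c\<in>?C. 1 / real c) - \<delta>\<^sup>2 * I * ln (real n)\<bar> \<le> \<bar>\<delta> * I\<bar> * B2"
      by (simp add: power2_eq_square mult_ac)
    show ?thesis using 1 2 by linarith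
  qed
  then have bound: "\<And>n. 1 \<le> n \<Longrightarrow> \<bar>A n - \<delta>\<^sup>2 * I / Z * Z * ln (real n)\<bar> \<le> 2 * B1 + \<bar>\<delta> * I\<bar> * B2"
    using Z0 by simp
  show ?thesis using dilation_sum_asymp[where S = S and A = A, OF P1 S0 A bound Z]
    unfolding S_def F_def .
qed

section \<open>Main terms over all and over odd coprime pairs\<close>

lemma dens_Riemann_sum:
  assumes "0 < c"
  shows "\<bar>(\<Sum>b<c. dens (real b / real c)) - real c * (ln 2 / 4)\<bar> \<le> 3"
  by (rule lipschitz_Riemann_sum[OF dens_lipschitz dens_has_integral assms])

lemma harm_minus_ln_bounds:
  assumes "1 \<le> n" shows "\<bar>harm n - ln (real n)\<bar> \<le> 1"
  using euler_mascheroni_sequence_nonneg[of n] euler_mascheroni_sequence_decreasing[of 1 n] assms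
  by (simp add: harm_expand)

lemma inverse_squares_sums_Suc: "(\<lambda>g. 1 / (real (Suc g))\<^sup>2) sums (pi\<^sup>2 / 6)"
  using inverse_squares_sums by (simp add: add.commute)

text \<open>The even squares carry a quarter of \<open>pi^2 / 6\<close>, which is
  subtracted.\<close>

lemma inverse_odd_squares_sums: "(\<lambda>g. (if odd (Suc g) then 1 else 0) / (real (Suc g))\<^sup>2) sums (pi\<^sup>2 / 8)"
proof -
  have "(\<lambda>g. 1 / 4 * (1 / (real (Suc g))\<^sup>2)) sums (1 / 4 * (pi\<^sup>2 / 6))"
    by (intro sums_mult inverse_squares_sums_Suc)
  then have "(\<lambda>g. 1 / (real (Suc (2 * g + 1)))\<^sup>2) sums (pi\<^sup>2 / 24)"
    by (simp add: power2_eq_square field_simps)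
  then have "(\<lambda>g. (if odd (Suc (2 * g + 1)) then 0 else 1) / (real (Suc (2 * g + 1)))\<^sup>2) sums (pi\<^sup>2 / 24)"
    by simp
  then have "(\<lambda>g. (if odd (Suc g) then 0 else 1) / (real (Suc g))\<^sup>2) sums (pi\<^sup>2 / 24)"
    by (subst (asm) sums_mono_reindex[of "\<lambda>g. 2 * g + 1"])
       (auto simp: strict_mono_def, metis oddE rangeI Suc_eq_plus1)
  from sums_diff[OF inverse_squares_sums_Suc this]
  have "(\<lambda>g. 1 / (real (Suc g))\<^sup>2 - (if odd (Suc g) then 0 else 1) / (real (Suc g))\<^sup>2) sums (pi\<^sup>2 / 8)"
    by simp
  also have "(\<lambda>g. 1 / (real (Suc g))\<^sup>2 - (if odd (Suc g) then 0 else 1) / (real (Suc g))\<^sup>2)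
     = (\<lambda>g. (if odd (Suc g) then 1 else 0) / (real (Suc g))\<^sup>2)" by auto
  finally show ?thesis .
qed

text \<open>The case of density 1 with \<open>Z = pi^2 / 6\<close>.\<close>

lemma coprime_pairs_all_dens_sum:
  "\<exists>C. \<forall>n\<ge>1. \<bar>(\<Sum>(b, c)\<in>coprime_pairs (\<lambda>_. True) n. dens (real b / real c) / (real c)\<^sup>2)
                 - 3 * ln 2 / (2 * pi\<^sup>2) * ln (real n)\<bar> \<le> C"
proof -
  have "\<exists>C. \<forall>n\<ge>1. \<bar>(\<Sum>(b, c)\<in>coprime_pairs (\<lambda>_. True) n. dens (real b / real c) / (real c)\<^sup>2)
                 - 1\<^sup>2 * (ln 2 / 4) / (pi\<^sup>2 / 6) * ln (real n)\<bar> \<le> C"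
  proof (rule coprime_pairs_dens_sum)
    show "\<bar>(\<Sum>b | b < c \<and> True. dens (real b / real c)) - 1 * (ln 2 / 4) * real c\<bar> \<le> 3" if "0 < c" for c
      using dens_Riemann_sum[OF that] by (simp add: lessThan_def mult.commute)
    show "\<bar>(\<Sum>c | c \<in> {1..n} \<and> True. 1 / real c) - 1 * ln (real n)\<bar> \<le> 1" if "1 \<le> n" for n
      using harm_minus_ln_bounds[OF that] by (simp add: harm_def atLeastAtMost_def atLeast_def atMost_def Int_def inverse_eq_divide)
    show "(\<lambda>g. (if True then 1 else 0) / (real (Suc g))\<^sup>2) sums (pi\<^sup>2 / 6)"
      using inverse_squares_sums_Suc by simp
  qed auto
  then show ?thesis by (simp add: mult_ac)
qed

text \<open>The case of density 1/2 with \<open>Z = pi^2 / 8\<close>. Sums over odd indices are half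
  the full sums up to alternating sums, which stay bounded by the Lipschitz property of
  \<open>dens\<close> and by convergence of the alternating harmonic series.\<close>

lemma coprime_pairs_odd_dens_sum:
  "\<exists>C. \<forall>n\<ge>1. \<bar>(\<Sum>(b, c)\<in>coprime_pairs odd n. dens (real b / real c) / (real c)\<^sup>2)
                 - ln 2 / (2 * pi\<^sup>2) * ln (real n)\<bar> \<le> C"
proof -
  have "convergent (\<lambda>n. \<Sum>c<n. (- 1) ^ c / real (Suc c))"
    using alternating_harmonic_series_sums unfolding sums_def convergent_def by blast
  from convergent_imp_Bseq[OF this]
  obtain K where "\<forall>n. norm (\<Sum>c<n. (- 1) ^ c / real (Suc c)) \<le> K"
    by (rule BseqE)
  then have K: "\<bar>\<Sum>c<n. (- 1) ^ c / real (Suc c)\<bar> \<le> K" for n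
    by simp
  have "\<exists>C. \<forall>n\<ge>1. \<bar>(\<Sum>(b, c)\<in>coprime_pairs odd n. dens (real b / real c) / (real c)\<^sup>2)
                 - (1 / 2)\<^sup>2 * (ln 2 / 4) / (pi\<^sup>2 / 8) * ln (real n)\<bar> \<le> C"
  proof (rule coprime_pairs_dens_sum)
    fix c :: nat assume c: "0 < c"
    let ?g = "\<lambda>b. dens (real b / real c)"
    have aux: "\<bar>s - e\<bar> \<le> 4" if "s = (x - y) / 2" "e = z / 2" "\<bar>y\<bar> \<le> 4" "\<bar>x - z\<bar> \<le> 3" for s e x y z :: real
      using that by (auto simp: abs_le_iff)
    have "\<bar>\<Sum>b<c. (- 1) ^ b * ?g b\<bar> \<le> real c * (3 / real c) + 1"
    proof (rule alternating_sum_bound)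
      fix b assume "Suc b < c"
      then have "\<bar>?g (Suc b) - ?g b\<bar> \<le> 3 * \<bar>real (Suc b) / real c - real b / real c\<bar>"
        by (intro dens_lipschitz) auto
      also have "real (Suc b) / real c - real b / real c = 1 / real c" using c by (simp add: field_simps)
      finally show "\<bar>?g (Suc b) - ?g b\<bar> \<le> 3 / real c" by simp
    next
      fix b assume "b < c"
      then show "\<bar>?g b\<bar> \<le> 1" using dens_bounds[of "real b / real c"] by auto
    qed auto
    then have alt: "\<bar>\<Sum>b<c. (- 1) ^ b * ?g b\<bar> \<le> 4" using c by simp
    have "(\<Sum>b | b < c \<and> odd b. ?g b) = ((\<Sum>b<c. ?g b) - (\<Sum>b<c. (- 1) ^ b * ?g b)) / 2"
      using sum_odd_eq[of "{..<c}" ?g] by simp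
    moreover have "1 / 2 * (ln 2 / 4) * real c = real c * (ln 2 / 4) / 2" by simp
    ultimately show "\<bar>(\<Sum>b | b < c \<and> odd b. ?g b) - 1 / 2 * (ln 2 / 4) * real c\<bar> \<le> 4"
      using aux[OF _ _ alt dens_Riemann_sum[OF c]] by blast
  next
    fix n :: nat assume n: "1 \<le> n"
    have "(\<Sum>c\<in>{1..n}. (- 1) ^ c * (1 / real c)) = (\<Sum>c<n. - ((- 1) ^ c / real (Suc c)))"
      by (simp add: sum.atLeast1_atMost_eq)
    then have alt: "\<bar>\<Sum>c\<in>{1..n}. (- 1) ^ c * (1 / real c)\<bar> \<le> K"
      using K[of n] by (simp add: sum_negf)
    have "(\<Sum>c | c \<in> {1..n} \<and> odd c. 1 / real c) = (harm n - (\<Sum>c\<in>{1..n}. (- 1) ^ c * (1 / real c))) / 2"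
      using sum_odd_eq[of "{1..n}" "\<lambda>c. 1 / real c"] by (simp add: harm_def inverse_eq_divide)
    then show "\<bar>(\<Sum>c | c \<in> {1..n} \<and> odd c. 1 / real c) - 1 / 2 * ln (real n)\<bar> \<le> (K + 1) / 2"
      using alt harm_minus_ln_bounds[OF n] unfolding abs_le_iff by (simp add: field_simps)
  qed (use inverse_odd_squares_sums in auto)
  then show ?thesis by (simp add: mult_ac power2_eq_square)
qed

section \<open>Lattice points above a coprime pair\<close>

text \<open>\<open>d \<ge> (1 + slope b c) a\<close> is the conjunction of \<open>V \<ge> 0\<close> and \<open>X \<ge> Y\<close>.\<close>

definition slope :: "nat \<Rightarrow> nat \<Rightarrow> real" where
  "slope b c = max (2 * real b / (real c - real b)) ((real c - real b) / real b)"

text \<open>Taking reciprocals turns the \<open>max\<close> in \<open>slope\<close> into the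
  \<open>min\<close> in \<open>dens\<close>. The left side is twice the area of the triangle of the
  \<open>(a, d)\<close> for \<open>M = 1\<close>.\<close>

lemma slope_dens:
  assumes b: "0 < b" and bc: "b < c"
  shows "1 / (real c * (real b + real c + real c * slope b c)) = dens (real b / real c) / (real c)\<^sup>2"
proof -
  define x y where "x = real b" and "y = real c"
  have xy: "0 < x" "x < y" using assms by (auto simp: x_def y_def)
  define \<beta>1 \<beta>2 where "\<beta>1 = (x\<^sup>2 + y\<^sup>2) / x" and "\<beta>2 = (y\<^sup>2 + 2 * x * y - x\<^sup>2) / (y - x)"
  have p: "0 < x\<^sup>2 + y\<^sup>2" using xy by (simp add: add_pos_pos)
  have "x * x \<le> y * y" "0 < x * y" using xy by (auto intro: mult_mono)
  then have q: "0 < y\<^sup>2 + 2 * x * y - x\<^sup>2" unfolding power2_eq_square by linarith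
  have pos: "0 < \<beta>1" "0 < \<beta>2" unfolding \<beta>1_def \<beta>2_def using xy p q by auto
  have e1: "x + y + y * ((y - x) / x) = \<beta>1" unfolding \<beta>1_def using xy by (simp add: field_simps power2_eq_square)
  have e2: "x + y + y * (2 * x / (y - x)) = \<beta>2" unfolding \<beta>2_def using xy by (simp add: field_simps power2_eq_square)
  have "x + y + y * slope b c = max \<beta>2 \<beta>1"
    unfolding e1[symmetric] e2[symmetric] slope_def x_def[symmetric] y_def[symmetric]
    using xy by (simp add: max_add_distrib_right max_mult_distrib_left)
  then have "1 / (y * (x + y + y * slope b c)) = min (1 / (y * \<beta>1)) (1 / (y * \<beta>2))"
    using xy pos by (auto simp: max_def min_def divide_simps)
  also have "1 / (y * \<beta>1) = (x / y) / (1 + (x / y)\<^sup>2) / y\<^sup>2"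
    unfolding \<beta>1_def using xy p by (simp add: divide_simps power2_eq_square)
  also have "1 / (y * \<beta>2) = (1 - x / y) / (1 + 2 * (x / y) - (x / y)\<^sup>2) / y\<^sup>2"
  proof -
    have "1 + 2 * (x / y) - (x / y)\<^sup>2 = (y\<^sup>2 + 2 * x * y - x\<^sup>2) / y\<^sup>2" "1 - x / y = (y - x) / y"
      using xy by (simp_all add: field_simps power2_eq_square)
    then show ?thesis unfolding \<beta>2_def using xy q by (simp add: power2_eq_square)
  qed
  also have "min ((x / y) / (1 + (x / y)\<^sup>2) / y\<^sup>2) ((1 - x / y) / (1 + 2 * (x / y) - (x / y)\<^sup>2) / y\<^sup>2)
      = dens (x / y) / y\<^sup>2"
    unfolding dens_def by (subst min_divide_distrib_right) simp
  finally show ?thesis unfolding x_def y_def .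
qed

text \<open>With \<open>d = a + k e\<close>, the value of \<open>ramp\<close> is the number
  \<open>M - U\<close> of centers, cut off at 0.\<close>

definition fibre_sum :: "nat \<Rightarrow> nat \<Rightarrow> nat \<Rightarrow> nat \<Rightarrow> real" where
  "fibre_sum M k b c = (\<Sum>a\<in>{1..M}. \<Sum>e | e \<le> M \<and> slope b c * real a / real k \<le> real e.
     ramp (real M - real a * (real b + real c)) (real c * real k) (real e))"

text \<open>Here \<open>h a\<close> is the weight at the lower end of the range of \<open>e\<close>.
  Summing over \<open>e\<close> gives \<open>h^2 / (2 c k)\<close> with error \<open>h\<close>;
  summing over \<open>a\<close> then gives \<open>M^3 / (6 c k \<beta>)\<close>, with errors from
  the sum of \<open>h\<close> and from the single value \<open>h(0)^2 = M^2\<close>.\<close>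

lemma fibre_sum_estimate:
  assumes b: "0 < b" and bc: "b < c" and k: "0 < k"
  shows "\<bar>fibre_sum M k b c - (real M) ^ 3 / 6 * (dens (real b / real c) / (real c)\<^sup>2 / real k)\<bar>
     \<le> 2 * (real M)\<^sup>2 / real c"
proof -
  define \<sigma> where "\<sigma> = slope b c"
  define \<beta> where "\<beta> = real b + real c + real c * \<sigma>"
  define h where "h a = ramp (real M) \<beta> (real a)" for a :: nat
  have \<sigma>: "0 \<le> \<sigma>" unfolding \<sigma>_def slope_def using b bc by (auto simp: le_max_iff_disj)
  have c\<sigma>: "0 \<le> real c * \<sigma>" using \<sigma> by simp
  have \<beta>: "real c \<le> \<beta>" "0 < \<beta>" "1 \<le> \<beta>" unfolding \<beta>_def using b bc c\<sigma> by auto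
  have ck: "1 \<le> real c * real k" using mult_mono[of 1 "real c" 1 "real k"] bc k by auto
  have inner: "\<bar>(\<Sum>e | e \<le> M \<and> \<sigma> * real a / real k \<le> real e.
      ramp (real M - real a * (real b + real c)) (real c * real k) (real e)) - (h a)\<^sup>2 / (2 * (real c * real k))\<bar> \<le> h a" for a
  proof -
    have "ramp (real M - real a * (real b + real c)) (real c * real k) (\<sigma> * real a / real k) = h a"
      unfolding h_def ramp_def \<beta>_def using k by (simp add: field_simps)
    moreover have "real M - real a * (real b + real c) \<le> real c * real k * real M"
      using mult_right_mono[OF ck, of "real M"] by (smt (verit) mult_nonneg_nonneg of_nat_0_le_iff)
    ultimately show ?thesis
      using sum_ramp_power[of "real c * real k" 1 "real M - real a * (real b + real c)" M "\<sigma> * real a / real k"]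
        ck \<sigma> by (simp add: power2_eq_square)
  qed
  have M\<beta>: "real M \<le> \<beta> * real M" using mult_right_mono[OF \<beta>(3), of "real M"] by simp
  \<comment> \<open>The sum over \<open>a\<close> starts at 1: removing the term
    \<open>a = 0\<close> exactly cancels the extra first term in the upper bounds.\<close>
  have h0: "h 0 = real M" by (simp add: h_def ramp_def)
  have split0: "(\<Sum>a\<in>{0..M}. f a) = f 0 + (\<Sum>a\<in>{1..M}. f a)" for f :: "nat \<Rightarrow> real"
    by (simp add: sum.atLeast_Suc_atMost)
  have s1: "(\<Sum>a\<in>{1..M}. h a) \<le> (real M)\<^sup>2 / (2 * \<beta>)"
    using sum_ramp_power_atLeastAtMost(2)[OF \<beta>(2) _ M\<beta>, of 1 0] split0[of h] h0
    unfolding h_def by (simp add: power2_eq_square)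
  have s2: "(real M) ^ 3 / (3 * \<beta>) - (real M)\<^sup>2 \<le> (\<Sum>a\<in>{1..M}. (h a)\<^sup>2)"
    "(\<Sum>a\<in>{1..M}. (h a)\<^sup>2) \<le> (real M) ^ 3 / (3 * \<beta>)"
    using sum_ramp_power_atLeastAtMost[OF \<beta>(2) _ M\<beta>, of 2 0] split0[of "\<lambda>a. (h a)\<^sup>2"] h0
    unfolding h_def by (simp_all add: power3_eq_cube power2_eq_square)
  have A: "\<bar>fibre_sum M k b c - (\<Sum>a\<in>{1..M}. (h a)\<^sup>2) / (2 * (real c * real k))\<bar> \<le> (real M)\<^sup>2 / (2 * \<beta>)"
    unfolding fibre_sum_def sum_divide_distrib sum_subtractf[symmetric] \<sigma>_def[symmetric]
    by (rule order.trans[OF order.trans[OF sum_abs sum_mono] s1]) (rule inner)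
  have "(real M)\<^sup>2 / (2 * \<beta>) \<le> (real M)\<^sup>2 / real c"
    using \<beta> b bc by (intro divide_left_mono) auto
  note A = order.trans[OF A this]
  have main: "(real M) ^ 3 / (3 * \<beta>) / (2 * (real c * real k))
      = (real M) ^ 3 / 6 * (dens (real b / real c) / (real c)\<^sup>2 / real k)"
    unfolding slope_dens[OF b bc, symmetric] \<sigma>_def[symmetric] \<beta>_def[symmetric] by (simp add: mult_ac)
  have "\<bar>(\<Sum>a\<in>{1..M}. (h a)\<^sup>2) / (2 * (real c * real k)) - (real M) ^ 3 / (3 * \<beta>) / (2 * (real c * real k))\<bar>
      = \<bar>(\<Sum>a\<in>{1..M}. (h a)\<^sup>2) - (real M) ^ 3 / (3 * \<beta>)\<bar> / (2 * (real c * real k))"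
    unfolding diff_divide_distrib[symmetric] abs_divide by simp
  also have "\<dots> \<le> (real M)\<^sup>2 / (2 * (real c * real k))" using s2 by (intro divide_right_mono) auto
  also have "\<dots> \<le> (real M)\<^sup>2 / real c"
    using mult_mono[of "real c" "real c" 1 "2 * real k"] bc k by (intro divide_left_mono) auto
  finally have B: "\<bar>(\<Sum>a\<in>{1..M}. (h a)\<^sup>2) / (2 * (real c * real k)) - (real M) ^ 3 / (3 * \<beta>) / (2 * (real c * real k))\<bar>
      \<le> (real M)\<^sup>2 / real c" .
  show ?thesis using A B unfolding main by linarith
qed

text \<open>A coprime pair with even sum has two odd entries, so \<open>1 / k\<close> is the mean of
  1 and the indicator of odd pairs. The two logarithmic constants therefore average to
  \<open>ln 2 / pi^2\<close>, and each fibre supplies the factor 1/6.\<close>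

lemma fibre_sum_total:
  "\<exists>C. \<forall>M\<ge>1. \<bar>(\<Sum>(b, c)\<in>coprime_pairs (\<lambda>_. True) M. fibre_sum M (if even (b + c) then 1 else 2) b c)
       - ln 2 / (6 * pi\<^sup>2) * (real M) ^ 3 * ln (real M)\<bar> \<le> C * (real M) ^ 3"
proof -
  define w where "w b c = dens (real b / real c) / (real c)\<^sup>2" for b c :: nat
  define k where "k b c = (if even (b + c) then 1 else 2 :: nat)" for b c :: nat
  let ?U = "\<lambda>n. coprime_pairs (\<lambda>_. True) n" and ?V = "\<lambda>n. coprime_pairs odd n"
  obtain C1 where C1: "\<And>n. 1 \<le> n \<Longrightarrow> \<bar>(\<Sum>(b, c)\<in>?U n. w b c) - 3 * ln 2 / (2 * pi\<^sup>2) * ln (real n)\<bar> \<le> C1"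
    using coprime_pairs_all_dens_sum unfolding w_def by blast
  obtain C2 where C2: "\<And>n. 1 \<le> n \<Longrightarrow> \<bar>(\<Sum>(b, c)\<in>?V n. w b c) - ln 2 / (2 * pi\<^sup>2) * ln (real n)\<bar> \<le> C2"
    using coprime_pairs_odd_dens_sum unfolding w_def by blast
  have "\<bar>(\<Sum>(b, c)\<in>?U M. fibre_sum M (k b c) b c) - ln 2 / (6 * pi\<^sup>2) * (real M) ^ 3 * ln (real M)\<bar>
      \<le> (2 + (C1 + C2) / 12) * (real M) ^ 3" if M: "1 \<le> M" for M
  proof -
    have V: "?V M = {x \<in> ?U M. even (fst x + snd x)}"
      by (auto simp: coprime_pairs_def elim: coprime_common_divisor)
    have "(\<Sum>x\<in>?U M. if even (fst x + snd x) then case_prod w x else 0) = (\<Sum>(b, c)\<in>?V M. w b c)"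
      unfolding V by (rule sum.inter_filter[symmetric]) simp
    moreover have "(\<Sum>(b, c)\<in>?U M. w b c / real (k b c))
        = (\<Sum>x\<in>?U M. (case_prod w x + (if even (fst x + snd x) then case_prod w x else 0)) / 2)"
      by (intro sum.cong) (auto simp: k_def)
    ultimately have W: "(\<Sum>(b, c)\<in>?U M. w b c / real (k b c)) = (\<Sum>(b, c)\<in>?U M. w b c) / 2 + (\<Sum>(b, c)\<in>?V M. w b c) / 2"
      by (simp only: sum.distrib add_divide_distrib flip: sum_divide_distrib)
    have aux: "\<bar>u / 2 + v / 2 - (x / 2 + y / 2)\<bar> \<le> (D1 + D2) / 2" if "\<bar>u - x\<bar> \<le> D1" "\<bar>v - y\<bar> \<le> D2"
      for u v x y D1 D2 :: real
      using that unfolding abs_le_iff by (simp add: field_simps)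
    have coef: "ln 2 / pi\<^sup>2 * L = (3 * ln 2 / (2 * pi\<^sup>2) * L) / 2 + (ln 2 / (2 * pi\<^sup>2) * L) / 2" for L
      by (simp add: field_simps)
    have "\<bar>(\<Sum>(b, c)\<in>?U M. w b c / real (k b c)) - ln 2 / pi\<^sup>2 * ln (real M)\<bar> \<le> (C1 + C2) / 2"
      unfolding W coef using C1[OF M] C2[OF M] by (rule aux)
    then have "(real M) ^ 3 / 6 * \<bar>(\<Sum>(b, c)\<in>?U M. w b c / real (k b c)) - ln 2 / pi\<^sup>2 * ln (real M)\<bar>
        \<le> (real M) ^ 3 / 6 * ((C1 + C2) / 2)"
      by (rule mult_left_mono) simp
    moreover have "(real M) ^ 3 / 6 * \<bar>X - ln 2 / pi\<^sup>2 * L\<bar> = \<bar>(real M) ^ 3 / 6 * X - ln 2 / (6 * pi\<^sup>2) * (real M) ^ 3 * L\<bar>" for X L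
      by (subst abs_mult_pos') (simp_all add: right_diff_distrib mult_ac)
    ultimately have 1: "\<bar>(real M) ^ 3 / 6 * (\<Sum>(b, c)\<in>?U M. w b c / real (k b c)) - ln 2 / (6 * pi\<^sup>2) * (real M) ^ 3 * ln (real M)\<bar>
        \<le> (C1 + C2) / 12 * (real M) ^ 3"
      by (simp add: mult_ac)
    have "\<bar>(\<Sum>(b, c)\<in>?U M. fibre_sum M (k b c) b c) - (real M) ^ 3 / 6 * (\<Sum>(b, c)\<in>?U M. w b c / real (k b c))\<bar>
        = \<bar>\<Sum>(b, c)\<in>?U M. fibre_sum M (k b c) b c - (real M) ^ 3 / 6 * (w b c / real (k b c))\<bar>"
      by (simp add: sum_distrib_left sum_subtractf case_prod_beta)
    also have "\<dots> \<le> (\<Sum>(b, c)\<in>?U M. 2 * (real M)\<^sup>2 / real c)"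
      using fibre_sum_estimate unfolding w_def
      by (intro order.trans[OF sum_abs sum_mono]) (auto simp: coprime_pairs_def k_def)
    also have "\<dots> = (\<Sum>(c, b)\<in>prod.swap ` ?U M. 2 * (real M)\<^sup>2 / real c)"
      by (subst sum.reindex) (auto simp: case_prod_beta)
    \<comment> \<open>Without coprimality there are \<open>c\<close> values of \<open>b\<close> for
      each \<open>c\<close>, so the errors add up to \<open>2 M^2\<close> per
      \<open>c\<close>.\<close>
    also have "\<dots> \<le> (\<Sum>(c, b)\<in>Sigma {1..M} (\<lambda>c. {..<c}). 2 * (real M)\<^sup>2 / real c)"
      by (intro sum_mono2) (auto simp: coprime_pairs_def)
    also have "\<dots> = (\<Sum>c\<in>{1..M}. \<Sum>b<c. 2 * (real M)\<^sup>2 / real c)" by (subst sum.Sigma) auto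
    also have "\<dots> = (\<Sum>c\<in>{1..M}. 2 * (real M)\<^sup>2)" by (intro sum.cong) auto
    also have "\<dots> = 2 * (real M) ^ 3" by (simp add: power2_eq_square power3_eq_cube)
    finally have 2: "\<bar>(\<Sum>(b, c)\<in>?U M. fibre_sum M (k b c) b c) - (real M) ^ 3 / 6 * (\<Sum>(b, c)\<in>?U M. w b c / real (k b c))\<bar>
        \<le> 2 * (real M) ^ 3" .
    show ?thesis using 1 2 unfolding distrib_right by linarith
  qed
  then show ?thesis unfolding k_def by blast
qed

section \<open>Parametrization of symmetric solutions\<close>

lemma mset_sorted_eq_iff: "sorted xs \<Longrightarrow> sorted ys \<Longrightarrow> mset xs = mset ys \<longleftrightarrow> xs = ys"
  by (metis properties_for_sort)

lemma symmetric_about_four: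
  assumes "2 * c = of_int C"
  shows "symmetric_about c (mset [w, x, C - x, C - w])"
proof -
  have "of_int (C - z) - c = - (of_int z - c)" for z using assms by simp
  then show ?thesis unfolding symmetric_about_def
    by (simp only: mset.simps image_mset_add_mset image_mset_empty minus_minus) (simp add: add_mset_commute)
qed

text \<open>The reflection sending \<open>a\<close> to \<open>C - a\<close> permutes
  \<open>A\<close> and reverses its sorted list, so the outer entries and the inner entries each sum
  to \<open>C\<close>.\<close>

lemma symmetric_four_sorted:
  fixes A :: "int multiset"
  assumes sz: "size A = 4" and c: "2 * c = of_int C" and sym: "symmetric_about c A"
  obtains w x where "w \<le> x" "2 * x \<le> C" "A = mset [w, x, C - x, C - w]"
proof -
  have "image_mset (\<lambda>a. c - of_int a) A = image_mset (\<lambda>a. of_int a - c) A"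
    using sym by (simp add: symmetric_about_def multiset.map_comp comp_def)
  \<comment> \<open>Adding \<open>c\<close> and taking the floor undoes the shift and carries the
    symmetry back to the integers.\<close>
  then have "image_mset (\<lambda>r. \<lfloor>r + c\<rfloor>) (image_mset (\<lambda>a. c - of_int a) A) = image_mset (\<lambda>r. \<lfloor>r + c\<rfloor>) (image_mset (\<lambda>a. of_int a - c) A)"
    by simp
  moreover have "\<lfloor>c - of_int a + c\<rfloor> = C - a" for a :: int
  proof -
    have "c - of_int a + c = of_int (C - a)" using c by simp
    then show ?thesis by (simp only: floor_of_int)
  qed
  ultimately have A: "image_mset (\<lambda>a. C - a) A = A"
    by (simp add: multiset.map_comp comp_def)
  define xs where "xs = sorted_list_of_multiset A"
  have xs: "mset xs = A" "sorted xs" by (simp_all add: xs_def)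
  have "length xs = 4" using xs sz by (metis size_mset)
  then obtain w x y z where l: "xs = [w, x, y, z]"
    by (auto simp: length_Suc_conv numeral_eq_Suc)
  have "mset [C - z, C - y, C - x, C - w] = A"
    using A unfolding xs(1)[symmetric] l by (simp add: add_mset_commute)
  then have "[C - z, C - y, C - x, C - w] = [w, x, y, z]"
    using xs unfolding l by (subst mset_sorted_eq_iff[symmetric]) auto
  then have "y = C - x" "z = C - w" by auto
  then show ?thesis using that[of w x] xs unfolding l by auto
qed

text \<open>
  With \<open>t\<close> the least element of the left multiset, the right outer pair lies \<open>p\<close> inside the left
  outer pair and the right inner pair lies \<open>r\<close> outside the left inner pair. In the notation of the
  header, \<open>p = (U - X) / 2\<close>, \<open>q = (U + X) / 2\<close>, \<open>r = (Y - V) / 2\<close>, \<open>s = (Y + V) / 2\<close>.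
\<close>

definition rects :: "nat \<Rightarrow> (nat \<times> nat \<times> nat \<times> nat) set" where
  "rects n = {(p, q, r, s). 0 < p \<and> 0 < r \<and> r \<le> s \<and> p + r + s \<le> q \<and> p * q = r * s
      \<and> even (p + q + r + s) \<and> p + q \<le> 2 * n}"

lemma finite_rects [simp]: "finite (rects n)"
  by (rule finite_subset[of _ "{..2*n} \<times> {..2*n} \<times> {..2*n} \<times> {..2*n}"]) (auto simp: rects_def)

text \<open>The halving is exact on \<open>rects\<close> by the parity condition there, and
  \<open>t + h\<close> is then the larger inner entry \<open>(C + Y) / 2\<close> on the
  right.\<close>

definition sol_left :: "int \<times> nat \<times> nat \<times> nat \<times> nat \<Rightarrow> int list" where
  "sol_left = (\<lambda>(t, p, q, r, s). let h = int ((p + q + r + s) div 2) in [t, t + h - int s, t + h - int r, t + int p + int q])"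

definition sol_right :: "int \<times> nat \<times> nat \<times> nat \<times> nat \<Rightarrow> int list" where
  "sol_right = (\<lambda>(t, p, q, r, s). let h = int ((p + q + r + s) div 2) in [t + int p, t + h - int r - int s, t + h, t + int q])"

text \<open>All other entries lie between \<open>t\<close> and \<open>t + p + q\<close>, so bounding
  these two bounds the height.\<close>

definition placed_rects :: "nat \<Rightarrow> (int \<times> nat \<times> nat \<times> nat \<times> nat) set" where
  "placed_rects n = {(t, p, q, r, s). (p, q, r, s) \<in> rects n \<and> - int n \<le> t \<and> t + int p + int q \<le> int n}"

text \<open>The base point \<open>t\<close> ranges over an integer interval, which is nonempty
  because \<open>p + q \<le> 2 * n\<close> on \<open>rects\<close>.\<close>

lemma card_placed_rects:
  "real (card (placed_rects n)) = (\<Sum>(p, q, r, s)\<in>rects n. real (2 * n + 1) - real (p + q))"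
proof -
  have "card (placed_rects n) = card (Sigma (rects n) (\<lambda>(p, q, r, s). {- int n .. int n - int p - int q}))"
    by (rule bij_betw_same_card[of prod.swap], rule bij_betwI[of _ _ _ prod.swap]) (auto simp: placed_rects_def)
  also have "\<dots> = (\<Sum>x\<in>rects n. card (case x of (p, q, r, s) \<Rightarrow> {- int n .. int n - int p - int q}))"
    by (rule card_SigmaI) auto
  finally show ?thesis
    unfolding of_nat_sum by (auto intro!: sum.cong simp: rects_def)
qed

section \<open>The bijection between solutions and placed rectangles\<close>

definition sym_sols :: "nat \<Rightarrow> int multiset set set" where
  "sym_sols n = {{A, B} | A B. pte3 A B \<and> A \<noteq> B \<and> pte_symmetric A B \<and> pte_height A B \<le> int n}"

lemma N_sym_eq_card_sym_sols:
  assumes "0 \<le> H" shows "N_sym H = card (sym_sols (nat \<lfloor>H\<rfloor>))"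
proof -
  have "of_int z \<le> H \<longleftrightarrow> z \<le> int (nat \<lfloor>H\<rfloor>)" for z :: int
    using assms by (simp add: le_floor_iff)
  then show ?thesis by (simp only: N_sym_def sym_sols_def)
qed

text \<open>Trades the division for an integer \<open>h\<close> with a linear equation, so that the
  power sum conditions become polynomial identities. Sortedness comes from \<open>r \<le> s\<close>
  and \<open>p + r + s \<le> q\<close>.\<close>

lemma sol_lists:
  assumes "(p, q, r, s) \<in> rects n"
  obtains h where "2 * h = int p + int q + int r + int s"
    "sol_left (t, p, q, r, s) = [t, t + h - int s, t + h - int r, t + int p + int q]"
    "sol_right (t, p, q, r, s) = [t + int p, t + h - int r - int s, t + h, t + int q]"
    "sorted (sol_left (t, p, q, r, s))" "sorted (sol_right (t, p, q, r, s))"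
proof -
  define h where "h = int ((p + q + r + s) div 2)"
  have "2 * ((p + q + r + s) div 2) = p + q + r + s"
    using assms by (simp add: rects_def)
  from arg_cong[OF this, of int] have h: "2 * h = int p + int q + int r + int s"
    by (simp add: h_def)
  have l: "sol_left (t, p, q, r, s) = [t, t + h - int s, t + h - int r, t + int p + int q]"
    "sol_right (t, p, q, r, s) = [t + int p, t + h - int r - int s, t + h, t + int q]"
    by (simp_all add: sol_left_def sol_right_def h_def Let_def)
  have i: "int r \<le> int s" "int p + int r + int s \<le> int q" using assms by (auto simp: rects_def)
  show ?thesis using that[OF h l] i h unfolding l by auto
qed

text \<open>The second and third power sums agree by \<open>p q = r s\<close>, and the two multisets
  differ in their least elements \<open>t\<close> and \<open>t + p\<close>.\<close>

lemma sol_in_sym_sols: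
  assumes "(t, p, q, r, s) \<in> placed_rects n"
  shows "{mset (sol_left (t, p, q, r, s)), mset (sol_right (t, p, q, r, s))} \<in> sym_sols n"
proof -
  have rect: "(p, q, r, s) \<in> rects n" and t: "- int n \<le> t" "t + int p + int q \<le> int n"
    using assms by (auto simp: placed_rects_def)
  have R: "0 < int p" "0 < int r" "int r \<le> int s" "int p + int r + int s \<le> int q" "int p * int q = int r * int s"
    using rect by (auto simp: rects_def simp flip: of_nat_mult)
  obtain h where h: "2 * h = int p + int q + int r + int s"
    and l: "sol_left (t, p, q, r, s) = [t, t + h - int s, t + h - int r, t + int p + int q]"
    and rr: "sol_right (t, p, q, r, s) = [t + int p, t + h - int r - int s, t + h, t + int q]"
    and so: "sorted (sol_left (t, p, q, r, s))" "sorted (sol_right (t, p, q, r, s))"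
    using sol_lists[OF rect, of t] by blast
  let ?A = "mset (sol_left (t, p, q, r, s))" and ?B = "mset (sol_right (t, p, q, r, s))"
  have pte: "pte3 ?A ?B"
  proof -
    have "{1..3::nat} = {1, 2, 3}" by auto
    moreover have "t + (t + h - int s) + (t + h - int r) + (t + int p + int q)
      = (t + int p) + (t + h - int r - int s) + (t + h) + (t + int q)" using h by simp
    moreover have "t\<^sup>2 + (t + h - int s)\<^sup>2 + (t + h - int r)\<^sup>2 + (t + int p + int q)\<^sup>2
      = (t + int p)\<^sup>2 + (t + h - int r - int s)\<^sup>2 + (t + h)\<^sup>2 + (t + int q)\<^sup>2" using h R(5) by algebra
    moreover have "t ^ 3 + (t + h - int s) ^ 3 + (t + h - int r) ^ 3 + (t + int p + int q) ^ 3
      = (t + int p) ^ 3 + (t + h - int r - int s) ^ 3 + (t + h) ^ 3 + (t + int q) ^ 3" using h R(5) by algebra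
    ultimately show ?thesis unfolding pte3_def l rr by (simp add: add.assoc)
  qed
  have neq: "?A \<noteq> ?B" using so R(1) unfolding l rr by (subst mset_sorted_eq_iff) auto
  have sym: "pte_symmetric ?A ?B"
  proof -
    define C where "C = 2 * t + int p + int q"
    define c :: real where "c = of_int C / 2"
    have c2: "2 * c = of_int C" by (simp add: c_def)
    have eqs: "t + h - int r = C - (t + h - int s)" "t + int p + int q = C - t"
      "t + h = C - (t + h - int r - int s)" "t + int q = C - (t + int p)"
      using h by (simp_all add: C_def)
    have "symmetric_about c ?A" unfolding l
      by (subst eqs(1), subst eqs(2)) (rule symmetric_about_four[OF c2])
    moreover have "symmetric_about c ?B" unfolding rr
      by (subst eqs(3), subst eqs(4)) (rule symmetric_about_four[OF c2])
    moreover have "2 * c \<in> \<int>" unfolding c2 by simp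
    ultimately show ?thesis unfolding pte_symmetric_def by blast
  qed
  have "pte_height ?A ?B \<le> int n"
    unfolding pte_height_def l rr using t R h by (subst Max_le_iff) auto
  then show ?thesis unfolding sym_sols_def using pte neq sym by blast
qed

lemma inj_on_sol:
  "inj_on (\<lambda>x. {mset (sol_left x), mset (sol_right x)}) (placed_rects n)"
proof (rule inj_onI)
  fix x x' assume x: "x \<in> placed_rects n" and x': "x' \<in> placed_rects n"
    and eq: "{mset (sol_left x), mset (sol_right x)} = {mset (sol_left x'), mset (sol_right x')}"
  obtain t p q r s where xt: "x = (t, p, q, r, s)" and R: "(p, q, r, s) \<in> rects n"
    using x by (auto simp: placed_rects_def)
  obtain t' p' q' r' s' where xt': "x' = (t', p', q', r', s')" and R': "(p', q', r', s') \<in> rects n"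
    using x' by (auto simp: placed_rects_def)
  obtain h where h: "2 * h = int p + int q + int r + int s"
    and l: "sol_left x = [t, t + h - int s, t + h - int r, t + int p + int q]"
    and rr: "sol_right x = [t + int p, t + h - int r - int s, t + h, t + int q]"
    and so: "sorted (sol_left x)" "sorted (sol_right x)"
    using sol_lists[OF R, of t] unfolding xt by blast
  obtain h' where h': "2 * h' = int p' + int q' + int r' + int s'"
    and l': "sol_left x' = [t', t' + h' - int s', t' + h' - int r', t' + int p' + int q']"
    and rr': "sol_right x' = [t' + int p', t' + h' - int r' - int s', t' + h', t' + int q']"
    and so': "sorted (sol_left x')" "sorted (sol_right x')"
    using sol_lists[OF R', of t'] unfolding xt' by blast
  have pos: "0 < p" "0 < p'" using R R' by (auto simp: rects_def)
  from eq consider "sol_left x = sol_left x'" "sol_right x = sol_right x'"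
    | "sol_left x = sol_right x'" "sol_right x = sol_left x'"
    using so so' by (auto simp: doubleton_eq_iff mset_sorted_eq_iff)
  then show "x = x'"
  proof cases
    case 1
    then have "t = t'" "p = p'" "q = q'" "s = s'" "r = r'" using h h' unfolding l l' rr rr' by auto
    then show ?thesis unfolding xt xt' by simp
  next
    \<comment> \<open>Interchanging the sides is impossible: comparing least elements would give
      \<open>t = t' + p'\<close> and \<open>t + p = t'\<close> with \<open>p\<close> and
      \<open>p'\<close> positive.\<close>
    case 2
    then show ?thesis using pos unfolding l l' rr rr' by simp
  qed
qed

text \<open>Equality of the sums of squares factors as \<open>p q = r s\<close>. The strict
  inequality \<open>w < w'\<close> makes this product positive, and \<open>0 \<le> s\<close> then
  forces \<open>r\<close> and \<open>s\<close> to be positive.\<close>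

lemma ex_placed_rect:
  fixes w x w' x' C :: int
  assumes o: "w \<le> x" "2 * x \<le> C" "w' \<le> x'" "2 * x' \<le> C" and lt: "w < w'"
    and sq: "w\<^sup>2 + x\<^sup>2 + (C - x)\<^sup>2 + (C - w)\<^sup>2 = w'\<^sup>2 + x'\<^sup>2 + (C - x')\<^sup>2 + (C - w')\<^sup>2"
    and ht: "- int n \<le> w" "C - w \<le> int n"
  obtains y where "y \<in> placed_rects n" "sol_left y = [w, x, C - x, C - w]" "sol_right y = [w', x', C - x', C - w']"
proof -
  define p q r s where "p = w' - w" and "q = C - w' - w" and "r = x - x'" and "s = C - x - x'"
  have prod: "p * q = r * s" using sq unfolding p_def q_def r_def s_def by algebra
  have p0: "0 < p" "0 < q" using lt o by (auto simp: p_def q_def)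
  then have "0 < r * s" unfolding prod[symmetric] by simp
  moreover have "0 \<le> s" using o by (simp add: s_def)
  ultimately have r0: "0 < r" "0 < s" by (auto simp: zero_less_mult_iff)
  have i: "r \<le> s" "p + r + s \<le> q" "p + q \<le> 2 * int n"
    using o ht by (simp_all add: p_def q_def r_def s_def)
  have h: "p + q + r + s = 2 * (C - x' - w)" by (simp add: p_def q_def r_def s_def)
  obtain p' q' r' s' :: nat where nat: "p = int p'" "q = int q'" "r = int r'" "s = int s'"
    using p0 r0 by (metis zero_less_imp_eq_int)
  have n: "0 < p'" "0 < r'" "r' \<le> s'" "p' + r' + s' \<le> q'" "p' + q' \<le> 2 * n"
    using p0 r0 i unfolding nat by simp_all
  have prod': "p' * q' = r' * s'" using prod unfolding nat by (metis of_nat_eq_iff of_nat_mult)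
  have "even (int (p' + q' + r' + s'))" using h unfolding nat by simp
  then have ev: "even (p' + q' + r' + s')" by (simp only: even_of_nat)
  have R: "(p', q', r', s') \<in> rects n" using n prod' ev by (simp add: rects_def)
  obtain h' where h': "2 * h' = int p' + int q' + int r' + int s'"
    and l: "sol_left (w, p', q', r', s') = [w, w + h' - int s', w + h' - int r', w + int p' + int q']"
    and rr: "sol_right (w, p', q', r', s') = [w + int p', w + h' - int r' - int s', w + h', w + int q']"
    using sol_lists[OF R, of w] by blast
  have hh: "h' = C - x' - w" using h h' unfolding nat by simp
  show ?thesis
  proof (rule that[of "(w, p', q', r', s')"])
    show "(w, p', q', r', s') \<in> placed_rects n"
      unfolding placed_rects_def using R ht nat by (auto simp: p_def q_def)
    show "sol_left (w, p', q', r', s') = [w, x, C - x, C - w]"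
      unfolding l hh nat[symmetric] by (simp add: p_def q_def r_def s_def)
    show "sol_right (w, p', q', r', s') = [w', x', C - x', C - w']"
      unfolding rr hh nat[symmetric] by (simp add: p_def q_def r_def s_def)
  qed
qed

text \<open>Of the two multisets, the one with the smaller least element is taken as the left one;
  equal least elements would make the multisets equal.\<close>

lemma sym_sols_eq_image:
  "sym_sols n = (\<lambda>x. {mset (sol_left x), mset (sol_right x)}) ` placed_rects n"
proof
  show "(\<lambda>x. {mset (sol_left x), mset (sol_right x)}) ` placed_rects n \<subseteq> sym_sols n"
    using sol_in_sym_sols by (auto simp: placed_rects_def)
  show "sym_sols n \<subseteq> (\<lambda>x. {mset (sol_left x), mset (sol_right x)}) ` placed_rects n"
  proof
    fix X assume "X \<in> sym_sols n"
    then obtain A B where X: "X = {A, B}" and pte: "pte3 A B" and neq: "A \<noteq> B"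
      and sym: "pte_symmetric A B" and ht: "pte_height A B \<le> int n"
      by (auto simp: sym_sols_def)
    obtain c where c: "2 * c \<in> \<int>" "symmetric_about c A" "symmetric_about c B"
      using sym by (auto simp: pte_symmetric_def)
    obtain C where C: "2 * c = of_int C" using c(1) by (auto elim: Ints_cases)
    have sz: "size A = 4" "size B = 4" using pte by (auto simp: pte3_def)
    obtain w x where wx: "w \<le> x" "2 * x \<le> C" "A = mset [w, x, C - x, C - w]"
      using symmetric_four_sorted[OF sz(1) C c(2)] .
    obtain w' x' where wx': "w' \<le> x'" "2 * x' \<le> C" "B = mset [w', x', C - x', C - w']"
      using symmetric_four_sorted[OF sz(2) C c(3)] .
    have "(\<Sum>a\<in>#A. a ^ 2) = (\<Sum>b\<in>#B. b ^ 2)" using pte by (auto simp: pte3_def)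
    then have sq: "w\<^sup>2 + x\<^sup>2 + (C - x)\<^sup>2 + (C - w)\<^sup>2 = w'\<^sup>2 + x'\<^sup>2 + (C - x')\<^sup>2 + (C - w')\<^sup>2"
      unfolding wx(3) wx'(3) by (simp add: add.assoc)
    have "\<forall>a\<in>set_mset A \<union> set_mset B. \<bar>a\<bar> \<le> int n"
      using ht unfolding pte_height_def wx(3) wx'(3) by (subst (asm) Max_le_iff) auto
    then have b: "- int n \<le> w" "C - w \<le> int n" "- int n \<le> w'" "C - w' \<le> int n"
      unfolding wx(3) wx'(3) by auto
    have "w \<noteq> w'"
    proof
      assume "w = w'"
      with sq have "(x - x') * (x + x' - C) = 0" by algebra
      \<comment> \<open>Since \<open>2 * x \<le> C\<close> and \<open>2 * x' \<le> C\<close>, the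
        second factor vanishes only if both equal half of \<open>C\<close>.\<close>
      then have "x = x'" using wx(2) wx'(2) by auto
      then show False using neq \<open>w = w'\<close> wx(3) wx'(3) by simp
    qed
    then consider "w < w'" | "w' < w" by linarith
    then show "X \<in> (\<lambda>x. {mset (sol_left x), mset (sol_right x)}) ` placed_rects n"
    proof cases
      case 1
      obtain y where "y \<in> placed_rects n" "sol_left y = [w, x, C - x, C - w]" "sol_right y = [w', x', C - x', C - w']"
        using ex_placed_rect[OF wx(1,2) wx'(1,2) 1 sq b(1,2)] .
      then show ?thesis unfolding X wx(3) wx'(3) by (intro image_eqI[of _ _ y]) auto
    next
      case 2
      obtain y where "y \<in> placed_rects n" "sol_left y = [w', x', C - x', C - w']" "sol_right y = [w, x, C - x, C - w]"
        using ex_placed_rect[OF wx'(1,2) wx(1,2) 2 sq[symmetric] b(3,4)] .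
      then show ?thesis unfolding X wx(3) wx'(3) by (intro image_eqI[of _ _ y]) auto
    qed
  qed
qed

lemma N_sym_eq_rects_sum:
  assumes "0 \<le> H" and n: "n = nat \<lfloor>H\<rfloor>"
  shows "real (N_sym H) = (\<Sum>(p, q, r, s)\<in>rects n. real (2 * n + 1) - real (p + q))"
  unfolding N_sym_eq_card_sym_sols[OF assms(1)] n[symmetric] sym_sols_eq_image card_image[OF inj_on_sol]
  by (rule card_placed_rects)

section \<open>From rectangles to lattice points above coprime pairs\<close>

definition step :: "nat \<Rightarrow> nat \<Rightarrow> nat" where
  "step b c = (if even (b + c) then 1 else 2)"

lemma step_pos [simp]: "0 < step b c"
  by (simp add: step_def)

text \<open>With \<open>d = a + k e\<close>, the two conditions on the right are
  \<open>p + r + s \<le> q\<close> and \<open>r \<le> s\<close>, freed of denominators.\<close>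

lemma slope_le_iff:
  assumes "0 < b" "b < c" "0 < k"
  shows "slope b c * real a / real k \<le> real e \<longleftrightarrow> 2 * a * b + b * k * e \<le> c * k * e \<and> a * c \<le> b * k * e + a * b"
proof -
  have "slope b c * real a / real k \<le> real e \<longleftrightarrow> slope b c * real a \<le> real k * real e"
    using assms by (simp add: divide_le_eq mult.commute)
  also have "\<dots> \<longleftrightarrow> 2 * real b / (real c - real b) * real a \<le> real k * real e \<and> (real c - real b) / real b * real a \<le> real k * real e"
    unfolding slope_def by (simp add: max_mult_distrib_right)
  also have "2 * real b / (real c - real b) * real a \<le> real k * real e \<longleftrightarrow> real (2 * a * b + b * k * e) \<le> real (c * k * e)"
    using assms by (simp add: divide_le_eq algebra_simps)
  also have "(real c - real b) / real b * real a \<le> real k * real e \<longleftrightarrow> real (a * c) \<le> real (b * k * e + a * b)"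
    using assms by (simp add: divide_le_eq algebra_simps)
  finally show ?thesis unfolding of_nat_le_iff .
qed

text \<open>Take \<open>a\<close> to be the gcd of \<open>p\<close> and \<open>r\<close>. Cancelling
  it leaves \<open>b q = c s\<close>, and coprimality makes \<open>c\<close> divide
  \<open>q\<close>.\<close>

lemma mult_eq_mult_coprime_factors:
  fixes p q r s :: nat
  assumes "p * q = r * s" "0 < p" "0 < r"
  obtains a b c d where "coprime b c" "p = a * b" "q = c * d" "r = a * c" "s = b * d"
proof -
  define a where "a = gcd p r"
  have a: "a \<noteq> 0" using assms by (simp add: a_def)
  then obtain b c where bc: "p = a * b" "r = a * c" "coprime b c"
    using gcd_coprime_exists[of p r] unfolding a_def by (metis mult.commute)
  have eq: "b * q = c * s" using assms(1) a unfolding bc by simp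
  then have "c dvd q" using bc(3) by (metis coprime_commute coprime_dvd_mult_right_iff dvd_triv_left)
  then obtain d where d: "q = c * d" ..
  have "c \<noteq> 0" using assms(3) bc by auto
  then have "s = b * d" using eq unfolding d by simp
  then show ?thesis using that bc d by blast
qed

text \<open>
  A pair \<open>(a, e)\<close> stands for \<open>d = a + k e\<close> with \<open>k\<close> the step: the order conditions force \<open>d \<ge> a\<close>, and
  the parity condition says that \<open>k\<close> divides \<open>d - a\<close>.
\<close>

definition quads :: "nat \<Rightarrow> ((nat \<times> nat) \<times> nat \<times> nat) set" where
  "quads M = Sigma (coprime_pairs (\<lambda>_. True) M) (\<lambda>(b, c). Sigma {1..M} (\<lambda>a.
     {e. e \<le> M \<and> slope b c * real a / real (step b c) \<le> real e}))"

definition quad_rect :: "(nat \<times> nat) \<times> nat \<times> nat \<Rightarrow> nat \<times> nat \<times> nat \<times> nat" where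
  "quad_rect = (\<lambda>((b, c), (a, e)). (a * b, c * (a + step b c * e), a * c, b * (a + step b c * e)))"

lemma quads_iff:
  "((b, c), (a, e)) \<in> quads M \<longleftrightarrow> 0 < b \<and> b < c \<and> c \<le> M \<and> coprime b c \<and> 0 < a \<and> a \<le> M \<and> e \<le> M
     \<and> 2 * a * b + b * step b c * e \<le> c * step b c * e \<and> a * c \<le> b * step b c * e + a * b"
  unfolding quads_def by (auto simp: coprime_pairs_def slope_le_iff)

text \<open>\<open>a\<close> is recovered as the gcd of the first and third coordinates, then
  \<open>b\<close> and \<open>c\<close> by division, and finally \<open>e\<close>.\<close>

lemma inj_on_quad_rect: "inj_on quad_rect (quads M)"
proof (rule inj_onI)
  fix y y' assume y: "y \<in> quads M" "y' \<in> quads M" "quad_rect y = quad_rect y'"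
  obtain b c a e where y1: "y = ((b, c), (a, e))" by (metis surj_pair)
  obtain b' c' a' e' where y2: "y' = ((b', c'), (a', e'))" by (metis surj_pair)
  have x: "((b, c), (a, e)) \<in> quads M" and x': "((b', c'), (a', e')) \<in> quads M"
    and eq: "quad_rect ((b, c), (a, e)) = quad_rect ((b', c'), (a', e'))"
    using y unfolding y1 y2 by auto
  have e1: "a * b = a' * b'" "a * c = a' * c'" and e2: "c * (a + step b c * e) = c' * (a' + step b' c' * e')"
    using eq by (auto simp: quad_rect_def)
  have cop: "gcd b c = 1" "gcd b' c' = 1" and pos: "0 < a" "0 < c" using x x' by (auto simp: quads_iff)
  have "a * gcd b c = a' * gcd b' c'" unfolding gcd_mult_distrib_nat e1 ..
  then have a: "a = a'" using cop by simp
  then have bc: "b = b'" "c = c'" using e1 pos by auto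
  then have "e = e'" using e2 a pos step_pos[of b' c'] by simp
  then show "y = y'" using a bc unfolding y1 y2 by simp
qed

lemma quad_rect_image:
  "quad_rect ` {x \<in> quads (2 * n + 1). (case quad_rect x of (p, q, r, s) \<Rightarrow> p + q \<le> 2 * n)} = rects n"
proof (intro equalityI subsetI)
  fix y assume "y \<in> quad_rect ` {x \<in> quads (2 * n + 1). (case quad_rect x of (p, q, r, s) \<Rightarrow> p + q \<le> 2 * n)}"
  then obtain b c a e where x: "((b, c), (a, e)) \<in> quads (2 * n + 1)"
    and y: "y = quad_rect ((b, c), (a, e))" and le: "case quad_rect ((b, c), (a, e)) of (p, q, r, s) \<Rightarrow> p + q \<le> 2 * n"
    by auto
  define k where "k = step b c"
  have i: "0 < b" "b < c" "0 < a" "2 * a * b + b * k * e \<le> c * k * e" "a * c \<le> b * k * e + a * b"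
    using x unfolding quads_iff k_def by auto
  have y': "y = (a * b, c * (a + k * e), a * c, b * (a + k * e))"
    unfolding y quad_rect_def k_def by simp
  have "even (a * b + c * (a + k * e) + a * c + b * (a + k * e))"
    by (auto simp: k_def step_def)
  moreover have "0 < a * b" "0 < a * c" "a * c \<le> b * (a + k * e)"
    "a * b + a * c + b * (a + k * e) \<le> c * (a + k * e)"
    "a * b * (c * (a + k * e)) = a * c * (b * (a + k * e))"
    using i by (simp_all add: algebra_simps)
  moreover have "a * b + c * (a + k * e) \<le> 2 * n"
    using le unfolding y[symmetric] y' by simp
  ultimately show "y \<in> rects n" unfolding y' rects_def by blast
next
  fix y assume "y \<in> rects n"
  then obtain p q r s where y: "y = (p, q, r, s)" and R: "0 < p" "0 < r" "r \<le> s" "p + r + s \<le> q" "p * q = r * s"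
      "even (p + q + r + s)" "p + q \<le> 2 * n"
    by (auto simp: rects_def)
  obtain a b c d where cop: "coprime b c" and f: "p = a * b" "q = c * d" "r = a * c" "s = b * d"
    using mult_eq_mult_coprime_factors[OF R(5,1,2)] .
  have pos: "0 < a" "0 < b" "0 < c" using R(1,2) unfolding f by auto
  have ineq: "a * b + a * c + b * d \<le> c * d" "a * c \<le> b * d" using R(3,4) unfolding f by auto
  have "b * d < c * d" using ineq pos by (smt (verit) add_gr_0 less_add_same_cancel2 nat_0_less_mult_iff order_less_le_trans)
  then have bc: "b < c" by simp
  have ad: "a \<le> d"
  proof (rule ccontr)
    assume "\<not> a \<le> d"
    then have "c * d \<le> a * c" by simp
    moreover have "0 < a * b" using pos by simp
    ultimately show False using ineq(1) by linarith
  qed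
  have "step b c dvd d - a"
  proof (cases "even (b + c)")
    case False
    \<comment> \<open>The parity condition on the rectangle becomes a condition on
      \<open>a + d\<close>, since \<open>b + c\<close> is odd.\<close>
    have "p + q + r + s = (a + d) * (b + c)" unfolding f by (simp add: algebra_simps)
    then have "even (a + d)" using R(6) False by simp
    then have "even (d - a)" using ad by simp
    then show ?thesis using False by (simp add: step_def)
  qed (simp add: step_def)
  then obtain e where "d - a = step b c * e" ..
  then have d: "d = a + step b c * e" using ad by simp
  define k where "k = step b c"
  have le: "a * b + c * (a + k * e) \<le> 2 * n" using R(7) unfolding f d k_def .
  \<comment> \<open>The box bounds in \<open>quads\<close> lose nothing: \<open>a\<close>,
    \<open>c\<close> and \<open>e\<close> are each at most a summand of
    \<open>p + q\<close>.\<close>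
  have "a \<le> a * b" "c \<le> c * a" "e \<le> c * (k * e)"
    using pos step_pos[of b c] by (simp_all add: k_def Suc_le_eq)
  moreover have "a * b + c * a + c * (k * e) \<le> 2 * n" using le by (simp add: distrib_left)
  ultimately have bounds: "a \<le> 2 * n" "c \<le> 2 * n" "e \<le> 2 * n" by linarith+
  have "((b, c), (a, e)) \<in> quads (2 * n + 1)"
    unfolding quads_iff k_def[symmetric] using pos bc cop bounds ineq unfolding d k_def[symmetric]
    by (simp add: algebra_simps)
  moreover have "quad_rect ((b, c), (a, e)) = y" unfolding y f d quad_rect_def by simp
  ultimately show "y \<in> quad_rect ` {x \<in> quads (2 * n + 1). (case quad_rect x of (p, q, r, s) \<Rightarrow> p + q \<le> 2 * n)}"
    using R(7) unfolding y by force
qed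

lemma rects_sum_eq_fibre_sums:
  "(\<Sum>(p, q, r, s)\<in>rects n. real (2 * n + 1) - real (p + q))
   = (\<Sum>(b, c)\<in>coprime_pairs (\<lambda>_. True) (2 * n + 1). fibre_sum (2 * n + 1) (step b c) b c)"
proof -
  define M where "M = 2 * n + 1"
  define g where "g = (\<lambda>((b, c), (a, e)). ramp (real M - real a * (real b + real c)) (real c * real (step b c)) (real e))"
  have fin: "finite (quads M)" unfolding quads_def by (intro finite_SigmaI) (auto intro!: finite_SigmaI)
  have g: "g x = max 0 (real M - real (fst (quad_rect x) + fst (snd (quad_rect x))))" for x
    unfolding g_def ramp_def quad_rect_def by (auto simp: case_prod_beta algebra_simps)
  have "(\<Sum>(p, q, r, s)\<in>rects n. real M - real (p + q))
      = (\<Sum>x\<in>{x \<in> quads M. (case quad_rect x of (p, q, r, s) \<Rightarrow> p + q \<le> 2 * n)}. real M - real (fst (quad_rect x) + fst (snd (quad_rect x))))"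
    unfolding quad_rect_image[symmetric] M_def
    by (subst sum.reindex) (auto intro: inj_on_subset[OF inj_on_quad_rect] simp: case_prod_beta)
  also have "\<dots> = (\<Sum>x\<in>{x \<in> quads M. (case quad_rect x of (p, q, r, s) \<Rightarrow> p + q \<le> 2 * n)}. g x)"
    by (intro sum.cong) (auto simp: g M_def case_prod_beta)
  also have "\<dots> = (\<Sum>x\<in>quads M. g x)"
    using fin by (intro sum.mono_neutral_left) (auto simp: g M_def case_prod_beta)
  also have "\<dots> = (\<Sum>x\<in>coprime_pairs (\<lambda>_. True) M. \<Sum>y\<in>(case x of (b, c) \<Rightarrow> Sigma {1..M} (\<lambda>a.
     {e. e \<le> M \<and> slope b c * real a / real (step b c) \<le> real e})). g (x, y))"
    unfolding quads_def by (subst sum.Sigma) (auto intro!: finite_SigmaI)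
  also have "\<dots> = (\<Sum>(b, c)\<in>coprime_pairs (\<lambda>_. True) M. fibre_sum M (step b c) b c)"
  proof (intro sum.cong refl, clarify)
    fix b c
    show "(\<Sum>y\<in>Sigma {1..M} (\<lambda>a. {e. e \<le> M \<and> slope b c * real a / real (step b c) \<le> real e}). g ((b, c), y))
        = fibre_sum M (step b c) b c"
      unfolding fibre_sum_def g_def by (subst sum.Sigma) (auto intro!: sum.cong)
  qed
  finally show ?thesis unfolding M_def .
qed

section \<open>Asymptotics in terms of the height\<close>

lemma N_sym_asymp_odd:
  "\<exists>C. \<forall>H\<ge>0. \<bar>real (N_sym H) - ln 2 / (6 * pi\<^sup>2) * (real (2 * nat \<lfloor>H\<rfloor> + 1) ^ 3 * ln (real (2 * nat \<lfloor>H\<rfloor> + 1)))\<bar>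
      \<le> C * real (2 * nat \<lfloor>H\<rfloor> + 1) ^ 3"
proof -
  obtain C where C: "\<And>M. 1 \<le> M \<Longrightarrow> \<bar>(\<Sum>(b, c)\<in>coprime_pairs (\<lambda>_. True) M. fibre_sum M (step b c) b c)
       - ln 2 / (6 * pi\<^sup>2) * (real M) ^ 3 * ln (real M)\<bar> \<le> C * (real M) ^ 3"
    using fibre_sum_total unfolding step_def[symmetric] by blast
  show ?thesis
  proof (intro exI allI impI)
    fix H :: real assume "0 \<le> H"
    then show "\<bar>real (N_sym H) - ln 2 / (6 * pi\<^sup>2) * (real (2 * nat \<lfloor>H\<rfloor> + 1) ^ 3 * ln (real (2 * nat \<lfloor>H\<rfloor> + 1)))\<bar>
      \<le> C * real (2 * nat \<lfloor>H\<rfloor> + 1) ^ 3"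
      using C[of "2 * nat \<lfloor>H\<rfloor> + 1"] unfolding N_sym_eq_rects_sum[OF \<open>0 \<le> H\<close> refl] rects_sum_eq_fibre_sums
      by (simp only: mult.assoc)
  qed
qed

theorem theorem5p1:
  shows "(\<lambda>H::real. real (N_sym H) - 4 * ln 2 / (3 * pi ^ 2) * (H ^ 3 * ln H))
           \<in> O[at_top](\<lambda>H. H ^ 3)"
proof -
  define M where "M H = real (2 * nat \<lfloor>H\<rfloor> + 1)" for H :: real
  \<comment> \<open>Multiplied by the 8 from \<open>(2 H) ^ 3\<close>, this becomes the constant
    \<open>4 ln 2 / (3 pi^2)\<close>.\<close>
  define K where "K = ln 2 / (6 * pi\<^sup>2)"
  obtain C where C: "\<And>H. 0 \<le> H \<Longrightarrow> \<bar>real (N_sym H) - K * (M H ^ 3 * ln (M H))\<bar> \<le> C * M H ^ 3"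
    using N_sym_asymp_odd unfolding M_def K_def by blast
  have M: "2 * H - 1 \<le> M H" "M H \<le> 2 * H + 1" if "1 \<le> H" for H
    using that unfolding M_def by linarith+
  have bM: "(\<lambda>H. M H ^ 3) \<in> O[at_top](\<lambda>H. H ^ 3)"
  proof (rule landau_o.big_trans)
    show "(\<lambda>H. M H ^ 3) \<in> O[at_top](\<lambda>H. (2 * H + 1) ^ 3)"
      by (intro bigoI[of _ 1] eventually_mono[OF eventually_ge_at_top[of 1]])
         (use M in \<open>auto simp: M_def intro!: power_mono\<close>)
    show "(\<lambda>H::real. (2 * H + 1) ^ 3) \<in> O[at_top](\<lambda>H. H ^ 3)" by real_asymp
  qed
  have 1: "(\<lambda>H. real (N_sym H) - K * (M H ^ 3 * ln (M H))) \<in> O[at_top](\<lambda>H. H ^ 3)"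
  proof (rule landau_o.big_trans[OF _ bM])
    show "(\<lambda>H. real (N_sym H) - K * (M H ^ 3 * ln (M H))) \<in> O[at_top](\<lambda>H. M H ^ 3)"
      by (intro bigoI[of _ C] eventually_mono[OF eventually_ge_at_top[of 0]]) (use C in \<open>auto simp: M_def\<close>)
  qed
  \<comment> \<open>\<open>M H\<close> is within 1 of \<open>2 H\<close>, and the factor 2 inside
    the logarithm costs only \<open>8 ln 2 H^3\<close>.\<close>
  have 2: "(\<lambda>H. M H ^ 3 * ln (M H) - 8 * (H ^ 3 * ln H)) \<in> O[at_top](\<lambda>H. H ^ 3)"
  proof (rule landau_o.big_trans)
    \<comment> \<open>The discrepancies at the endpoints \<open>2 H + 1\<close> and
      \<open>2 H - 1\<close>; by monotonicity the one at \<open>M H\<close> lies between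
      them.\<close>
    define u l :: "real \<Rightarrow> real" where "u H = (2 * H + 1) ^ 3 * ln (2 * H + 1) - 8 * (H ^ 3 * ln H)"
      and "l H = (2 * H - 1) ^ 3 * ln (2 * H - 1) - 8 * (H ^ 3 * ln H)" for H
    show "(\<lambda>H. M H ^ 3 * ln (M H) - 8 * (H ^ 3 * ln H)) \<in> O[at_top](\<lambda>H. \<bar>u H\<bar> + \<bar>l H\<bar>)"
    proof (intro bigoI[of _ 1] eventually_mono[OF eventually_ge_at_top[of 1]])
      fix H :: real assume H: "1 \<le> H"
      have "(2 * H - 1) ^ 3 * ln (2 * H - 1) \<le> M H ^ 3 * ln (M H)"
        using M[OF H] H by (intro mult_mono power_mono) auto
      moreover have "M H ^ 3 * ln (M H) \<le> (2 * H + 1) ^ 3 * ln (2 * H + 1)"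
        using M[OF H] H by (intro mult_mono power_mono) auto
      ultimately show "norm (M H ^ 3 * ln (M H) - 8 * (H ^ 3 * ln H)) \<le> 1 * norm (\<bar>u H\<bar> + \<bar>l H\<bar>)"
        unfolding u_def l_def by simp
    qed
    have "(\<lambda>H. \<bar>u H\<bar>) \<in> O[at_top](\<lambda>H. H ^ 3)" unfolding landau_o.big.abs_in_iff u_def by real_asymp
    moreover have "(\<lambda>H. \<bar>l H\<bar>) \<in> O[at_top](\<lambda>H. H ^ 3)" unfolding landau_o.big.abs_in_iff l_def by real_asymp
    ultimately show "(\<lambda>H. \<bar>u H\<bar> + \<bar>l H\<bar>) \<in> O[at_top](\<lambda>H. H ^ 3)" by (rule sum_in_bigo)
  qed
  have "(\<lambda>H. (real (N_sym H) - K * (M H ^ 3 * ln (M H))) + K * (M H ^ 3 * ln (M H) - 8 * (H ^ 3 * ln H))) \<in> O[at_top](\<lambda>H. H ^ 3)"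
    using 2 by (intro sum_in_bigo(1)[OF 1]) (cases "K = 0", simp_all)
  then show ?thesis unfolding K_def by (simp add: algebra_simps)
qed

end
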